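(* Let $X$ be a real random variable and $K$ any finite constant. Let $\{X_{k,n}\}_{1\le k\le n,\ n\ge1}$ be a triangular array of real random variables such that, for each fixed $n$, $X_{1,n},\dots,X_{n,n}$ are independent and $K$-weakly mean dominated by $X$. Let $\{\tau_n\}_{n\ge1}$ be a sequence of nonnegative real numbers and let $\{a_n\}_{n\ge1}$ be a nondecreasing sequence of strictly positive real numbers. Put $S_n=X_{1,n}+\dots+X_{n,n}$. Suppose that: (1) there is a sequence $\{\mu_n\}_{n=1}^\infty$, with $\mu_n$ a median of $S_n$ for every $n$, such that for all $\varepsilon>0$ we have $\sum_{n\in M(\varepsilon)}\tau_n<\infty$, where $M(\varepsilon)=\{n\in\mathbb Z^+:|\mu_n|>\varepsilon a_n\}$; (2) there exist finite constants $\theta\ge1$, $C>0$ and $N\ge2$ such that for all $n\ge N$ $$\frac{a_n^{3\theta}}{n^{\theta-1}}\sum_{k=n}^\infty \frac{k^\theta\tau_k}{a_k^{3\theta}}\le C\sum_{k=1}^{n-1}k\tau_k,$$ and, if $\theta>1$, additionally $$\liminf_{n\to\infty}\ \inf_{k\ge n}\ \frac{a_k^3}{k\,a_n^3}\sum_{j=1}^{n-1}j\tau_j>0;$$ (3) $\sum_{n=1}^\infty n\tau_nP(|X|\ge\varepsilon a_n)<\infty$ for all $\varepsilon>0$; (4) $\sum_{n=1}^\infty\tau_ne^{-\varepsilon^2a_n^2/(nT_{\varepsilon,n})}<\infty$ for all $\varepsilon>0$, where $T_{\varepsilon,n}=E[X^2\cdot1_{\{|X|<\varepsilon a_n\}}]$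 and $e^{-t/0}=0$ for all $t>0$. Then $$\sum_{n=1}^\infty\tau_nP(|S_n|\ge\varepsilon a_n)<\infty\quad\text{for all }\varepsilon>0.$$
   Context: Random variables $Y_1,\dots,Y_n$ are said to be $K$-weakly mean dominated by a random variable $X$ if for all $\lambda$ we have $\frac1n\sum_{k=1}^nP(|Y_k|\ge\lambda)\le K\,P(|X|\ge\lambda)$. *)

theory Defs
  imports "HOL-Probability.Probability"
begin

(* The dominating variable X may live on its own probability space N: the notion
   only involves distributions. *)
definition weakly_mean_dominated ::
  "real \<Rightarrow> 'b measure \<Rightarrow> nat \<Rightarrow> (nat \<Rightarrow> 'b \<Rightarrow> real) \<Rightarrow> 'a measure \<Rightarrow> ('a \<Rightarrow> real) \<Rightarrow> bool"
where
  "weakly_mean_dominated K M n Y N X \<longleftrightarrow>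
    (\<forall>t::real. (1 / real n) * (\<Sum>k=1..n. \<P>(\<omega> in M. \<bar>Y k \<omega>\<bar> \<ge> t))
                 \<le> K * \<P>(\<omega> in N. \<bar>X \<omega>\<bar> \<ge> t))"

definition is_median :: "'b measure \<Rightarrow> ('b \<Rightarrow> real) \<Rightarrow> real \<Rightarrow> bool" where
  "is_median M Z m \<longleftrightarrow> \<P>(\<omega> in M. Z \<omega> \<le> m) \<ge> 1 / 2 \<and> \<P>(\<omega> in M. Z \<omega> \<ge> m) \<ge> 1 / 2"

definition row_sum :: "(nat \<Rightarrow> nat \<Rightarrow> 'b \<Rightarrow> real) \<Rightarrow> nat \<Rightarrow> 'b \<Rightarrow> real" where
  "row_sum Y n \<omega> = (\<Sum>k=1..n. Y k n \<omega>)"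

definition truncated_second_moment :: "'a measure \<Rightarrow> ('a \<Rightarrow> real) \<Rightarrow> real \<Rightarrow> real" where
  "truncated_second_moment N X c =
    integral\<^sup>L N (\<lambda>\<omega>. (X \<omega>)\<^sup>2 * indicator {x. \<bar>x\<bar> < c} (X \<omega>))"

(* exp (- t / s), with the convention exp (- t / 0) = 0; HOL's t / 0 = 0 would give 1. *)
definition exp_neg_div :: "real \<Rightarrow> real \<Rightarrow> real" where
  "exp_neg_div t s = (if s = 0 then 0 else exp (- (t / s)))"

end

theory Submission
  imports Defs
begin

text \<open>
  Truncate the variables of row \<open>n\<close> at \<open>\<delta> a\<^sub>n\<close>. A Fuk--Nagaev inequality bounds the tail of the
  centred truncated sum by a Gaussian term, summable by the fourth hypothesis, and by a power at
  least \<open>\<theta>\<close> of \<open>D\<^sub>n + n P(|X| \<ge> \<delta> a\<^sub>n)\<close>, where \<open>D\<^sub>n\<close> is \<open>n\<close> times the truncated third moment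
  of \<open>X\<close> divided by \<open>(\<delta> a\<^sub>n)\<^sup>3\<close>. The regularity hypothesis is what makes the series of
  \<open>\<tau>\<^sub>n D\<^sub>n powr \<theta>\<close> converge: its second half keeps \<open>D\<^sub>n\<close> bounded, after which summation by parts
  reduces the series to that of \<open>n \<tau>\<^sub>n P(|X| \<ge> \<delta> a\<^sub>n)\<close>. The mean of the truncated sum is
  controlled through the median of \<open>S\<^sub>n\<close>: if the two are far apart, then the deviation and
  truncation probabilities add up to at least one half.
\<close>

subsection \<open>Series of powers of truncated moments\<close>

text \<open>Mean value theorem, with the intermediate derivative at most its value at
  \<open>y\<close> because \<open>p - 1\<close> is nonnegative. The case \<open>x = 0\<close> is
  computed directly, since the derivative rule for \<open>powr\<close> is applied on a positive
  interval only.\<close>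

lemma powr_diff_le:
  fixes x y p :: real
  assumes "0 \<le> x" "x \<le> y" "1 \<le> p"
  shows "y powr p - x powr p \<le> p * y powr (p - 1) * (y - x)"
proof (cases "x = y")
  case False
  then have xy: "x < y" using assms by simp
  show ?thesis
  proof (cases "x = 0")
    case True
    have "y powr p = y powr (p - 1) * y"
      using xy assms powr_add[of y "p - 1" 1] by simp
    also have "\<dots> \<le> p * (y powr (p - 1) * y)"
      using assms by (intro mult_right_mono[of 1 p, simplified]) auto
    finally show ?thesis using True assms by (simp add: mult.assoc)
  next
    case False
    then have x: "x > 0" using assms by simp
    have "\<exists>z. x < z \<and> z < y \<and> y powr p - x powr p = (y - x) * (p * z powr (p - 1))"
    proof (rule MVT2[OF xy])
      fix t assume "x \<le> t" "t \<le> y"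
      then show "((\<lambda>t. t powr p) has_real_derivative p * t powr (p - 1)) (at t)"
        using x by (intro has_real_derivative_powr) auto
    qed
    then obtain z where z: "x < z" "z < y" "y powr p - x powr p = (y - x) * (p * z powr (p - 1))"
      by blast
    have "z powr (p - 1) \<le> y powr (p - 1)"
      using z x assms by (intro powr_mono2) auto
    then have "(y - x) * (p * z powr (p - 1)) \<le> (y - x) * (p * y powr (p - 1))"
      using xy assms by (intro mult_left_mono) auto
    with z(3) show ?thesis by (simp add: mult_ac)
  qed
qed auto

lemma summable_on_atLeast_boundedI:
  fixes f :: "nat \<Rightarrow> real"
  assumes nonneg: "\<And>n. n \<ge> m \<Longrightarrow> f n \<ge> 0"
    and bound: "\<And>n. n \<ge> m \<Longrightarrow> (\<Sum>k=m..n. f k) \<le> B"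
  shows "f summable_on {m..}"
proof (rule nonneg_bdd_above_summable_on)
  have "sum f F \<le> B" if F: "F \<subseteq> {m..}" "finite F" for F
  proof -
    define n where "n = Max (insert m F)"
    have "F \<subseteq> {m..n}" "m \<le> n" using F by (auto simp: n_def)
    then have "sum f F \<le> (\<Sum>k=m..n. f k)"
      using nonneg by (intro sum_mono2) auto
    then show ?thesis using bound[OF \<open>m \<le> n\<close>] by simp
  qed
  then show "bdd_above (sum f ` {F. F \<subseteq> {m..} \<and> finite F})"
    by (intro bdd_aboveI[of _ B]) auto
qed (use nonneg in auto)

text \<open>The new start may lie on either side of the old one: going down adds finitely many
  terms, going up passes to a subset.\<close>

lemma summable_on_atLeast_lower:
  fixes f :: "nat \<Rightarrow> real"
  assumes "f summable_on {m..}"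
  shows "f summable_on {n..}"
proof -
  have "f summable_on ({..<m} \<union> {m..})"
    using assms by (intro summable_on_Un_disjoint) auto
  then show ?thesis by (rule summable_on_subset) auto
qed

text \<open>Summation by parts, twice: once moving the weights \<open>w\<close> to the increments of
  \<open>H powr \<theta>\<close>, once moving \<open>W\<close> to the increments of \<open>Q\<close>.\<close>

lemma summable_truncated_moment_powr:
  fixes H Q \<tau> a :: "nat \<Rightarrow> real" and \<theta> C c :: real and m :: nat
  defines "W \<equiv> \<lambda>n. \<Sum>j=1..n-1. real j * \<tau> j"
    and "w \<equiv> \<lambda>k. real k powr \<theta> * \<tau> k / a k powr (3 * \<theta>)"
  assumes \<theta>: "\<theta> \<ge> 1" and m: "m \<ge> 1" and C: "C > 0"
    and \<tau>: "\<And>n. n \<ge> 1 \<Longrightarrow> \<tau> n \<ge> 0" and a: "\<And>n. n \<ge> 1 \<Longrightarrow> a n > 0"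
    and H: "\<And>n. n \<ge> 1 \<Longrightarrow> H n \<ge> 0" "\<And>n. n \<ge> 1 \<Longrightarrow> H n \<le> H (Suc n)"
      "\<And>n. n \<ge> 1 \<Longrightarrow> H (Suc n) - H n \<le> a (Suc n) ^ 3 * (Q n - Q (Suc n))"
    and Q: "\<And>n. n \<ge> 1 \<Longrightarrow> Q n \<ge> 0" "\<And>n. n \<ge> 1 \<Longrightarrow> Q (Suc n) \<le> Q n"
    and Qs: "(\<lambda>n. real n * \<tau> n * Q n) summable_on {1..}"
    and ws: "w summable_on {m..}"
    and reg: "\<And>n. n \<ge> m \<Longrightarrow>
       a n powr (3 * \<theta>) / real n powr (\<theta> - 1) * (\<Sum>\<^sub>\<infinity>k\<in>{n..}. w k) \<le> C * W n"
    and c: "\<theta> > 1 \<Longrightarrow> c > 0"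
      "\<And>n k. \<theta> > 1 \<Longrightarrow> n \<ge> m \<Longrightarrow> k \<ge> n \<Longrightarrow> c \<le> a k ^ 3 / (real k * a n ^ 3) * W n"
  shows "(\<lambda>n. \<tau> n * (real n * H n / a n ^ 3) powr \<theta>) summable_on {1..}"
proof -
  define A where "A = W (Suc m) * Q m + (\<Sum>\<^sub>\<infinity>n\<in>{1..}. real n * \<tau> n * Q n)"
  define D where "D n = real n * H n / a n ^ 3" for n
  define I where "I n = (\<Sum>\<^sub>\<infinity>k\<in>{n..}. w k)" for n
  have W_nonneg: "W n \<ge> 0" for n
    unfolding W_def using \<tau> by (intro sum_nonneg mult_nonneg_nonneg) auto
  have W_Suc: "W (Suc n) = W n + real n * \<tau> n" if "n \<ge> 1" for n
    using that by (cases n) (auto simp: W_def)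
  have A_bound: "(\<Sum>n=Suc m..k. W n * (Q (n - 1) - Q n)) \<le> A" if "k \<ge> m" for k
  proof -
    have "(\<Sum>n=Suc m..k. W n * (Q (n - 1) - Q n)) + W (Suc k) * Q k
        = W (Suc m) * Q m + (\<Sum>n=Suc m..k. real n * \<tau> n * Q n)"
      using that
    proof (induction k rule: dec_induct)
      case (step k)
      then have "W (Suc (Suc k)) = W (Suc k) + real (Suc k) * \<tau> (Suc k)"
        using W_Suc[of "Suc k"] by simp
      then show ?case using step by (simp add: algebra_simps)
    qed simp
    moreover have "(\<Sum>n=Suc m..k. real n * \<tau> n * Q n) \<le> (\<Sum>\<^sub>\<infinity>n\<in>{1..}. real n * \<tau> n * Q n)"
      using m \<tau> Q by (intro finite_sum_le_infsum[OF Qs]) auto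
    moreover have "W (Suc k) * Q k \<ge> 0"
      using W_nonneg Q that m by auto
    ultimately show ?thesis unfolding A_def by linarith
  qed
  have H_tele: "H k = H m + (\<Sum>n=Suc m..k. H n - H (n - 1))" if "k \<ge> m" for k
    using that by (induction k rule: dec_induct) auto
  \<comment> \<open>This bound on \<open>D\<close> absorbs the factor
    \<open>H powr (\<theta> - 1)\<close> that differentiating \<open>H powr \<theta>\<close>
    produces. For \<theta> > 1 it comes from telescoping \<open>H\<close>, bounding its increments
    by those of \<open>Q\<close>, and comparing with the Abel sum \<open>A\<close>.\<close>
  obtain B where B: "B \<ge> 0" "\<And>k. k \<ge> m \<Longrightarrow> D k powr (\<theta> - 1) \<le> B"
  proof (cases "\<theta> > 1")
    case True
    note c = c(1)[OF True] c(2)[OF True]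
    have "D k \<le> (H m * W m / a m ^ 3 + A) / c" if k: "k \<ge> m" for k
    proof -
      have k1: "k \<ge> 1" using k m by simp
      \<comment> \<open>The lower bound by \<open>c\<close>, rearranged: the factor belonging to the
        final index \<open>k\<close> is traded for the weight \<open>W n\<close>, uniformly in
        \<open>k\<close>. This is what makes \<open>A_bound\<close> applicable below.\<close>
      have a3: "real k / a k ^ 3 * a n ^ 3 \<le> W n / c" if "n \<ge> m" "n \<le> k" for n
      proof -
        have "c \<le> a k ^ 3 / (real k * a n ^ 3) * W n" using c(2) that by blast
        moreover have "a k ^ 3 > 0" "a n ^ 3 > 0" using a[of k] a[of n] m that by auto
        ultimately show ?thesis using c(1) k1 by (simp add: field_simps)
      qed
      have k3: "real k / a k ^ 3 \<ge> 0" using a[of k] k1 by simp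
      have "D k = real k / a k ^ 3 * H m + (\<Sum>n=Suc m..k. real k / a k ^ 3 * (H n - H (n - 1)))"
        unfolding sum_distrib_left[symmetric] distrib_left[symmetric] H_tele[OF k, symmetric]
        by (simp add: D_def)
      also have "\<dots> \<le> H m * W m / a m ^ 3 / c + (\<Sum>n=Suc m..k. W n * (Q (n - 1) - Q n) / c)"
      proof (intro add_mono sum_mono)
        have "real k / a k ^ 3 \<le> W m / c / a m ^ 3"
          using a3[of m] k a[of m] m by (subst pos_le_divide_eq) auto
        then have "real k / a k ^ 3 * H m \<le> W m / c / a m ^ 3 * H m"
          using H(1)[of m] m by (intro mult_right_mono) auto
        then show "real k / a k ^ 3 * H m \<le> H m * W m / a m ^ 3 / c"
          by (simp add: field_simps)
      next
        fix n assume n: "n \<in> {Suc m..k}"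
        then obtain l where l: "n = Suc l" "l \<ge> m" by (cases n) auto
        have "real k / a k ^ 3 * (H n - H (n - 1)) \<le> real k / a k ^ 3 * (a n ^ 3 * (Q (n - 1) - Q n))"
          using H(3)[of l] l m k3 by (intro mult_left_mono) auto
        also have "\<dots> = (real k / a k ^ 3 * a n ^ 3) * (Q (n - 1) - Q n)" by simp
        also have "\<dots> \<le> W n / c * (Q (n - 1) - Q n)"
          using a3[of n] n Q(2)[of l] l m by (intro mult_right_mono) auto
        finally show "real k / a k ^ 3 * (H n - H (n - 1)) \<le> W n * (Q (n - 1) - Q n) / c" by simp
      qed
      also have "\<dots> \<le> H m * W m / a m ^ 3 / c + A / c"
        using A_bound[OF k] c(1)
        by (simp add: sum_divide_distrib[symmetric] divide_right_mono)
      finally show ?thesis by (simp add: add_divide_distrib)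
    qed
    moreover have "D k \<ge> 0" if "k \<ge> m" for k
      using H(1)[of k] a[of k] that m by (auto simp: D_def)
    ultimately have "D k powr (\<theta> - 1) \<le> ((H m * W m / a m ^ 3 + A) / c) powr (\<theta> - 1)" if "k \<ge> m" for k
      using that True by (intro powr_mono2) auto
    then show ?thesis using that powr_ge_zero by blast
  next
    case False
    \<comment> \<open>Here the power is \<open>D k powr 0\<close>, which is 1, or 0 when
      \<open>D k = 0\<close>; so 1 is a bound in both cases.\<close>
    with \<theta> have "\<theta> = 1" by simp
    then show ?thesis by (intro that[of 1]) auto
  qed
  have w_nonneg: "w k \<ge> 0" for k
    using \<tau>[of k] unfolding w_def by (cases "k = 0") auto
  have I_Suc: "I k = w k + I (Suc k)" if "k \<ge> m" for k
  proof -
    have "w summable_on {Suc k..}" using ws by (rule summable_on_atLeast_lower)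
    moreover have "{k..} = insert k {Suc k..}" by auto
    ultimately show ?thesis unfolding I_def by (simp add: infsum_insert)
  qed
  have I_nonneg: "I k \<ge> 0" for k
    unfolding I_def using w_nonneg by (intro infsum_nonneg) auto
  \<comment> \<open>Three estimates are multiplied: \<open>reg\<close> for the tail
    \<open>I k\<close>, the mean value bound for the increment of \<open>H powr \<theta>\<close>,
    and \<open>H(3)\<close> for the increment of \<open>H\<close>. The powers of \<open>k\<close>,
    \<open>a k\<close> and \<open>H k\<close> left over combine exactly to
    \<open>D k powr (\<theta> - 1)\<close>, hence are at most \<open>B\<close>.\<close>
  have incr: "I k * (H k powr \<theta> - H (k - 1) powr \<theta>) \<le> \<theta> * C * B * (W k * (Q (k - 1) - Q k))"
    if k: "k \<ge> Suc m" for k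
  proof -
    obtain l where l: "k = Suc l" "l \<ge> m" using k by (cases k) auto
    have ak: "a k > 0" and k0: "real k > 0" using a[of k] k by auto
    have H0: "H k \<ge> 0" "H (k - 1) \<ge> 0" "H (k - 1) \<le> H k" using H[of l] H(1)[of k] l m by auto
    have Q0: "Q (k - 1) - Q k \<ge> 0" using Q(2)[of l] l m by auto
    define E where "E = real k powr (\<theta> - 1) / a k powr (3 * \<theta>)"
    have E0: "E \<ge> 0" by (simp add: E_def)
    have "I k \<le> E * (C * W k)"
      using reg[of k] k ak k0 by (simp add: I_def E_def field_simps)
    moreover have "H k powr \<theta> - H (k - 1) powr \<theta> \<ge> 0"
      using H0 \<theta> by (simp add: powr_mono2)
    ultimately have "I k * (H k powr \<theta> - H (k - 1) powr \<theta>)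
        \<le> E * (C * W k) * (\<theta> * H k powr (\<theta> - 1) * (H k - H (k - 1)))"
      using H0 \<theta> I_nonneg[of k] powr_diff_le[of "H (k - 1)" "H k" \<theta>]
      by (intro mult_mono) auto
    also have "\<dots> \<le> E * (C * W k) * (\<theta> * H k powr (\<theta> - 1) * (a k ^ 3 * (Q (k - 1) - Q k)))"
      using H(3)[of l] l m E0 C W_nonneg[of k] \<theta> by (intro mult_left_mono) auto
    also have "\<dots> = \<theta> * C * (E * a k ^ 3 * H k powr (\<theta> - 1)) * (W k * (Q (k - 1) - Q k))"
      by (simp add: mult_ac)
    also have "E * a k ^ 3 * H k powr (\<theta> - 1) = D k powr (\<theta> - 1)"
    proof -
      have "a k ^ 3 / a k powr (3 * \<theta>) = 1 / (a k ^ 3) powr (\<theta> - 1)"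
      proof -
        have e: "a k ^ 3 = a k powr 3" using ak by simp
        have "(a k ^ 3) powr (\<theta> - 1) = a k powr (3 * \<theta> - 3)"
          unfolding e powr_powr by (simp add: algebra_simps)
        also have "\<dots> = a k powr (3 * \<theta>) / a k ^ 3" unfolding e by (rule powr_diff)
        finally show ?thesis by simp
      qed
      then show ?thesis
        using ak H0 k0 by (simp add: D_def E_def powr_divide powr_mult field_simps)
    qed
    also have "\<theta> * C * D k powr (\<theta> - 1) * (W k * (Q (k - 1) - Q k))
        \<le> \<theta> * C * B * (W k * (Q (k - 1) - Q k))"
      using B(2)[of k] k \<theta> C W_nonneg[of k] Q0
      by (intro mult_right_mono mult_left_mono mult_nonneg_nonneg) auto
    finally show ?thesis .
  qed
  have "(\<lambda>n. w n * H n powr \<theta>) summable_on {m..}"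
  proof (rule summable_on_atLeast_boundedI)
    fix n assume n: "n \<ge> m"
    \<comment> \<open>Abel summation with \<open>w k = I k - I (Suc k)\<close>; the boundary term at
      \<open>n\<close> is nonnegative and is discarded afterwards.\<close>
    have "(\<Sum>k=m..n. w k * H k powr \<theta>) + I (Suc n) * H n powr \<theta>
        = I m * H m powr \<theta> + (\<Sum>k=Suc m..n. I k * (H k powr \<theta> - H (k - 1) powr \<theta>))"
      using n
    proof (induction n rule: dec_induct)
      case base
      then show ?case using I_Suc[of m] by (simp add: algebra_simps)
    next
      case (step n)
      then show ?case using I_Suc[of "Suc n"] by (simp add: algebra_simps)
    qed
    moreover have "I (Suc n) * H n powr \<theta> \<ge> 0" using I_nonneg by simp
    moreover have "(\<Sum>k=Suc m..n. I k * (H k powr \<theta> - H (k - 1) powr \<theta>))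
        \<le> (\<Sum>k=Suc m..n. \<theta> * C * B * (W k * (Q (k - 1) - Q k)))"
      using incr by (intro sum_mono) auto
    moreover have "\<dots> \<le> \<theta> * C * B * A"
      unfolding sum_distrib_left[symmetric] using A_bound[OF n] \<theta> C B
      by (intro mult_left_mono) auto
    ultimately show "(\<Sum>k=m..n. w k * H k powr \<theta>) \<le> I m * H m powr \<theta> + \<theta> * C * B * A"
      by linarith
  qed (use w_nonneg in auto)
  then have "(\<lambda>n. w n * H n powr \<theta>) summable_on {1..}"
    by (rule summable_on_atLeast_lower)
  moreover have "w n * H n powr \<theta> = \<tau> n * (real n * H n / a n ^ 3) powr \<theta>" if "n \<ge> 1" for n
  proof -
    have e: "a n ^ 3 = a n powr 3" using a[OF that] by simp
    have "(a n ^ 3) powr \<theta> = a n powr (3 * \<theta>)"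
      unfolding e powr_powr ..
    then show ?thesis using that a[OF that] H(1)[OF that]
      by (simp add: w_def powr_divide powr_mult)
  qed
  ultimately show ?thesis by (subst summable_on_cong[symmetric]) auto
qed

subsection \<open>Weak mean domination and exponential moments\<close>

text \<open>At level 0 every probability in the definition is 1. The lower bound on \<open>K\<close>
  is what later permits dividing by \<open>K\<close> and choosing a truncation level that depends on
  it.\<close>

lemma weakly_mean_dominated_const_ge_1:
  assumes "prob_space M" "prob_space N" "n \<ge> 1" "weakly_mean_dominated K M n Y N X"
  shows "K \<ge> 1"
proof -
  have "(1 / real n) * (\<Sum>k=1..n. \<P>(\<omega> in M. \<bar>Y k \<omega>\<bar> \<ge> 0)) \<le> K * \<P>(\<omega> in N. \<bar>X \<omega>\<bar> \<ge> 0)"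
    using assms(4) unfolding weakly_mean_dominated_def by blast
  then show ?thesis
    using assms(3) by (simp add: prob_space.prob_space[OF assms(1)] prob_space.prob_space[OF assms(2)])
qed

text \<open>Tonelli's theorem applied to \<open>f x\<close> written as the length of the interval
  from 0 to \<open>f x\<close>. It reduces moment comparisons to tail comparisons, the only
  information that weak mean domination provides.\<close>

lemma (in prob_space) nn_integral_layer_cake:
  fixes f :: "'a \<Rightarrow> real"
  assumes [measurable]: "f \<in> borel_measurable M" and nonneg: "\<And>x. f x \<ge> 0"
  shows "(\<integral>\<^sup>+x. ennreal (f x) \<partial>M) =
    (\<integral>\<^sup>+t. emeasure M {x \<in> space M. t \<le> f x} * indicator {0<..} t \<partial>lborel)"
proof -
  interpret pair_sigma_finite M lborel ..
  have "(\<integral>\<^sup>+x. ennreal (f x) \<partial>M) = (\<integral>\<^sup>+x. \<integral>\<^sup>+t. indicator {0<..f x} t \<partial>lborel \<partial>M)"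
    using nonneg by (intro nn_integral_cong) simp
  also have "\<dots> = (\<integral>\<^sup>+x. \<integral>\<^sup>+t. (if 0 < t \<and> t \<le> f x then 1 else 0) \<partial>lborel \<partial>M)"
    by (intro nn_integral_cong) (simp add: indicator_def)
  also have "\<dots> = (\<integral>\<^sup>+t. \<integral>\<^sup>+x. (if 0 < t \<and> t \<le> f x then 1 else 0) \<partial>M \<partial>lborel)"
    by (rule Fubini'[symmetric]) measurable
  also have "\<dots> = (\<integral>\<^sup>+t. emeasure M {x \<in> space M. t \<le> f x} * indicator {0<..} t \<partial>lborel)"
  proof (intro nn_integral_cong)
    fix t :: real
    have "(\<integral>\<^sup>+x. (if 0 < t \<and> t \<le> f x then 1 else 0) \<partial>M)
      = (\<integral>\<^sup>+x. indicator {0<..} t * indicator {x \<in> space M. t \<le> f x} x \<partial>M)"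
      by (intro nn_integral_cong) (auto simp: indicator_def)
    then show "(\<integral>\<^sup>+x. (if 0 < t \<and> t \<le> f x then 1 else 0) \<partial>M)
      = emeasure M {x \<in> space M. t \<le> f x} * indicator {0<..} t"
      by (simp add: nn_integral_cmult mult.commute)
  qed
  finally show ?thesis .
qed

text \<open>Superlevel sets of a capped power are tail events of \<open>\<bar>y\<bar>\<close> up to
  level \<open>c ^ p\<close> and empty beyond it, which is the form the domination hypothesis can
  handle.\<close>

lemma le_min_power_iff:
  fixes t c y :: real
  assumes "t > 0" "c \<ge> 0" "p > 0"
  shows "t \<le> min \<bar>y\<bar> c ^ p \<longleftrightarrow> t \<le> c ^ p \<and> root p t \<le> \<bar>y\<bar>"
proof -
  have "t \<le> z ^ p \<longleftrightarrow> root p t \<le> z" if "z \<ge> 0" for z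
    using assms that by (metis real_root_le_iff real_root_power_cancel)
  then show ?thesis using assms by (auto simp: min_def)
qed

text \<open>Domination is applied at each level of the layer cake formula. The variable is capped at
  \<open>c\<close> rather than set to 0 beyond it, because the capped power is monotone in the
  absolute value, so that its superlevel sets are tails.\<close>

lemma sum_expectation_min_power_le:
  fixes Y :: "nat \<Rightarrow> 'b \<Rightarrow> real" and X :: "'a \<Rightarrow> real"
  assumes M: "prob_space M" and N: "prob_space N"
    and Y: "\<And>k. k \<in> {1..n} \<Longrightarrow> Y k \<in> borel_measurable M"
    and X: "X \<in> borel_measurable N"
    and n: "n \<ge> 1" and dom: "weakly_mean_dominated K M n Y N X" and c: "c \<ge> 0" and p: "p > 0"
  shows "(\<Sum>k=1..n. \<integral>\<omega>. min \<bar>Y k \<omega>\<bar> c ^ p \<partial>M) \<le> real n * K * (\<integral>\<omega>. min \<bar>X \<omega>\<bar> c ^ p \<partial>N)"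
proof -
  interpret M: prob_space M by fact
  interpret N: prob_space N by fact
  note [measurable] = X
  have K: "K \<ge> 1" using weakly_mean_dominated_const_ge_1[OF M N n dom] .
  have int: "(\<integral>\<^sup>+\<omega>. ennreal (min \<bar>Z \<omega>\<bar> c ^ p) \<partial>P) = ennreal (\<integral>\<omega>. min \<bar>Z \<omega>\<bar> c ^ p \<partial>P)"
    if "prob_space P" and [measurable]: "Z \<in> borel_measurable P" for Z :: "'c \<Rightarrow> real" and P
  proof -
    interpret P: prob_space P by fact
    have "integrable P (\<lambda>\<omega>. min \<bar>Z \<omega>\<bar> c ^ p)"
      using c by (intro P.integrable_const_bound[where B="c ^ p"]) (auto intro!: power_mono)
    then show ?thesis using c by (intro nn_integral_eq_integral) auto
  qed
  have "ennreal (\<Sum>k=1..n. \<integral>\<omega>. min \<bar>Y k \<omega>\<bar> c ^ p \<partial>M) = (\<Sum>k=1..n. ennreal (\<integral>\<omega>. min \<bar>Y k \<omega>\<bar> c ^ p \<partial>M))"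
    using c by (intro sum_ennreal[symmetric] integral_nonneg) auto
  also have "\<dots> = (\<Sum>k=1..n. \<integral>\<^sup>+\<omega>. ennreal (min \<bar>Y k \<omega>\<bar> c ^ p) \<partial>M)"
    using int[OF M Y] by (intro sum.cong) auto
  also have "\<dots> = (\<Sum>k=1..n. \<integral>\<^sup>+t. emeasure M {x \<in> space M. t \<le> min \<bar>Y k x\<bar> c ^ p} * indicator {0<..} t \<partial>lborel)"
    using Y c by (intro sum.cong M.nn_integral_layer_cake) auto
  also have "\<dots> = (\<integral>\<^sup>+t. (\<Sum>k=1..n. emeasure M {x \<in> space M. t \<le> min \<bar>Y k x\<bar> c ^ p} * indicator {0<..} t) \<partial>lborel)"
  proof (rule nn_integral_sum[symmetric])
    fix k assume "k \<in> {1..n}"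
    then have [measurable]: "Y k \<in> borel_measurable M" by (rule Y)
    show "(\<lambda>t. emeasure M {x \<in> space M. t \<le> min \<bar>Y k x\<bar> c ^ p} * indicator {0<..} t)
        \<in> borel_measurable lborel" by measurable
  qed
  also have "\<dots> \<le> (\<integral>\<^sup>+t. ennreal (real n * K) * (emeasure N {x \<in> space N. t \<le> min \<bar>X x\<bar> c ^ p} * indicator {0<..} t) \<partial>lborel)"
  proof (intro nn_integral_mono)
    fix t :: real
    show "(\<Sum>k=1..n. emeasure M {x \<in> space M. t \<le> min \<bar>Y k x\<bar> c ^ p} * indicator {0<..} t)
      \<le> ennreal (real n * K) * (emeasure N {x \<in> space N. t \<le> min \<bar>X x\<bar> c ^ p} * indicator {0<..} t)"
    proof (cases "0 < t \<and> t \<le> c ^ p")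
      case True
      have "(\<Sum>k=1..n. M.prob {x \<in> space M. root p t \<le> \<bar>Y k x\<bar>})
          \<le> real n * K * N.prob {x \<in> space N. root p t \<le> \<bar>X x\<bar>}"
        using dom[unfolded weakly_mean_dominated_def, rule_format, of "root p t"] n
        by (simp add: field_simps)
      then show ?thesis using True c p K
        by (simp add: le_min_power_iff M.emeasure_eq_measure N.emeasure_eq_measure
              flip: ennreal_mult) 
    next
      case False
      then show ?thesis using c p by (auto simp: le_min_power_iff)
    qed
  qed
  also have "\<dots> = ennreal (real n * K) * (\<integral>\<^sup>+t. (emeasure N {x \<in> space N. t \<le> min \<bar>X x\<bar> c ^ p} * indicator {0<..} t) \<partial>lborel)"
    by (intro nn_integral_cmult) measurable
  also have "\<dots> = ennreal (real n * K) * (\<integral>\<^sup>+\<omega>. ennreal (min \<bar>X \<omega>\<bar> c ^ p) \<partial>N)"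
    using c by (subst N.nn_integral_layer_cake) auto
  also have "\<dots> = ennreal (real n * K * (\<integral>\<omega>. min \<bar>X \<omega>\<bar> c ^ p \<partial>N))"
    using K c by (subst int[OF N X]) (auto intro!: ennreal_mult[symmetric] integral_nonneg)
  finally show ?thesis
    using K c by (subst (asm) ennreal_le_iff) (auto intro!: mult_nonneg_nonneg integral_nonneg)
qed

section \<open>Exponential bounds for sums of bounded independent variables\<close>

lemma exp_le_Taylor_cubic:
  fixes x :: real
  shows "exp x \<le> 1 + x + x\<^sup>2 / 2 + \<bar>x\<bar> ^ 3 * exp \<bar>x\<bar> / 6"
proof -
  obtain t where t: "\<bar>t\<bar> \<le> \<bar>x\<bar>" "exp x = (\<Sum>m<3. x ^ m / fact m) + exp t / fact 3 * x ^ 3"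
    using Maclaurin_exp_le[of x 3] by blast
  have "exp t * x ^ 3 \<le> exp t * \<bar>x\<bar> ^ 3"
    using abs_ge_self[of "x ^ 3"] by (intro mult_left_mono) (auto simp: power_abs)
  also have "\<dots> \<le> exp \<bar>x\<bar> * \<bar>x\<bar> ^ 3"
    using t(1) by (intro mult_right_mono) auto
  finally have "exp t * x ^ 3 \<le> exp \<bar>x\<bar> * \<bar>x\<bar> ^ 3" .
  then show ?thesis
    unfolding t(2) by (simp add: eval_nat_numeral mult.commute)
qed

text \<open>Chernoff's inequality, with each exponential moment bounded by the cubic expansion and
  \<open>1 + y \<le> exp y\<close>. The uncentred variable is expanded, so raw second and third
  moments appear; the linear term \<open>h * m i\<close> then cancels against the centring.\<close>

lemma (in prob_space) prob_sum_ge_le_exp: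
  fixes U :: "'i \<Rightarrow> 'a \<Rightarrow> real"
  assumes fin: "finite I" and indep: "indep_vars (\<lambda>_. borel) U I"
    and bounded: "\<And>i x. i \<in> I \<Longrightarrow> \<bar>U i x\<bar> \<le> b" and h: "h > 0"
  shows "prob {x \<in> space M. (\<Sum>i\<in>I. U i x) - (\<Sum>i\<in>I. expectation (U i)) \<ge> s}
    \<le> exp (- (h * s) + h\<^sup>2 * (\<Sum>i\<in>I. expectation (\<lambda>x. (U i x)\<^sup>2)) / 2
            + h ^ 3 * exp (h * b) * (\<Sum>i\<in>I. expectation (\<lambda>x. \<bar>U i x\<bar> ^ 3)) / 6)"
proof -
  define m where "m i = expectation (U i)" for i
  define v where "v i = h\<^sup>2 * expectation (\<lambda>x. (U i x)\<^sup>2) / 2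
    + h ^ 3 * exp (h * b) * expectation (\<lambda>x. \<bar>U i x\<bar> ^ 3) / 6" for i
  have U_meas: "U i \<in> borel_measurable M" if "i \<in> I" for i
    using indep that by (auto simp: indep_vars_def)
  have mgf: "(\<integral>\<^sup>+x. ennreal (exp (h * (U i x - m i))) \<partial>M) \<le> ennreal (exp (v i))" if i: "i \<in> I" for i
  proof -
    note [measurable] = U_meas[OF i]
    \<comment> \<open>The bound holds at every point of the type, so an arbitrary one gives the sign
      of \<open>b\<close>.\<close>
    have b: "b \<ge> 0" using bounded[OF i, of undefined] by linarith
    have 1: "integrable M (U i)"
      using bounded[OF i] by (intro integrable_const_bound[where B=b]) auto
    have pw: "\<bar>U i x\<bar> ^ p \<le> b ^ p" for x p
      using bounded[OF i] by (intro power_mono) auto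
    have 2: "integrable M (\<lambda>x. (U i x)\<^sup>2)"
      using pw[of _ 2] by (intro integrable_const_bound[where B="b\<^sup>2"]) auto
    have 3: "integrable M (\<lambda>x. \<bar>U i x\<bar> ^ 3)"
      using pw[of _ 3] by (intro integrable_const_bound[where B="b ^ 3"]) auto
    have 4: "integrable M (\<lambda>x. exp (h * U i x))"
    proof (intro integrable_const_bound[where B="exp (h * b)"] AE_I2)
      fix x
      have "h * U i x \<le> h * b" using bounded[OF i, of x] h by (intro mult_left_mono) auto
      then show "norm (exp (h * U i x)) \<le> exp (h * b)" by simp
    qed measurable
    have "exp (h * U i x) \<le> 1 + h * U i x + h\<^sup>2 / 2 * (U i x)\<^sup>2
        + h ^ 3 * exp (h * b) / 6 * \<bar>U i x\<bar> ^ 3" for x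
    proof -
      have "h ^ 3 * \<bar>U i x\<bar> ^ 3 * exp (h * \<bar>U i x\<bar>) \<le> h ^ 3 * \<bar>U i x\<bar> ^ 3 * exp (h * b)"
        using bounded[OF i, of x] h by (intro mult_left_mono) auto
      moreover have "exp (h * U i x) \<le> 1 + h * U i x + h\<^sup>2 * (U i x)\<^sup>2 / 2
          + h ^ 3 * \<bar>U i x\<bar> ^ 3 * exp (h * \<bar>U i x\<bar>) / 6"
        using exp_le_Taylor_cubic[of "h * U i x"] h by (simp add: abs_mult power_mult_distrib)
      ultimately show ?thesis by (simp add: mult_ac)
    qed
    then have "expectation (\<lambda>x. exp (h * U i x))
        \<le> expectation (\<lambda>x. 1 + h * U i x + h\<^sup>2 / 2 * (U i x)\<^sup>2 + h ^ 3 * exp (h * b) / 6 * \<bar>U i x\<bar> ^ 3)"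
      using 1 2 3 4 by (intro integral_mono) auto
    also have "\<dots> = 1 + (h * m i + v i)"
      using 1 2 3 by (simp add: m_def v_def prob_space)
    also have "\<dots> \<le> exp (h * m i + v i)"
      using exp_ge_add_one_self[of "h * m i + v i"] by simp
    finally have le: "expectation (\<lambda>x. exp (h * U i x)) \<le> exp (h * m i + v i)" .
    have "(\<integral>\<^sup>+x. ennreal (exp (h * (U i x - m i))) \<partial>M)
        = (\<integral>\<^sup>+x. ennreal (exp (- (h * m i)) * exp (h * U i x)) \<partial>M)"
      by (intro nn_integral_cong) (simp add: exp_add[symmetric] algebra_simps)
    also have "\<dots> = ennreal (exp (- (h * m i)) * expectation (\<lambda>x. exp (h * U i x)))"
      using 4 by (subst nn_integral_eq_integral) auto
    also have "\<dots> \<le> ennreal (exp (- (h * m i)) * exp (h * m i + v i))"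
      using le by (intro ennreal_leI mult_left_mono) auto
    also have "exp (- (h * m i)) * exp (h * m i + v i) = exp (v i)"
      by (simp add: exp_add[symmetric])
    finally show ?thesis .
  qed
  have sum_meas: "(\<lambda>x. (\<Sum>i\<in>I. U i x) - (\<Sum>i\<in>I. m i)) \<in> borel_measurable M"
    using U_meas by (intro borel_measurable_diff borel_measurable_sum) auto
  have "ennreal (prob {x \<in> space M. (\<Sum>i\<in>I. U i x) - (\<Sum>i\<in>I. m i) \<ge> s})
      = emeasure M {x \<in> space M. (\<Sum>i\<in>I. U i x) - (\<Sum>i\<in>I. m i) \<ge> s}"
    by (simp add: emeasure_eq_measure)
  also have "\<dots> \<le> ennreal (exp (- h * s)) *
      (\<integral>\<^sup>+x\<in>space M. exp (h * ((\<Sum>i\<in>I. U i x) - (\<Sum>i\<in>I. m i))) \<partial>M)"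
    using sum_meas by (intro Chernoff_ineq_nn_integral_ge h) auto
  also have "(\<integral>\<^sup>+x\<in>space M. exp (h * ((\<Sum>i\<in>I. U i x) - (\<Sum>i\<in>I. m i))) \<partial>M) =
      (\<integral>\<^sup>+x. (\<Prod>i\<in>I. ennreal (exp (h * (U i x - m i)))) \<partial>M)"
    by (intro nn_integral_cong)
       (simp_all add: sum_distrib_left ring_distribs exp_diff exp_sum fin prod_ennreal prod_dividef)
  also have "\<dots> = (\<Prod>i\<in>I. \<integral>\<^sup>+x. ennreal (exp (h * (U i x - m i))) \<partial>M)"
    by (intro indep_vars_nn_integral fin indep_vars_compose2[OF indep]) auto
  also have "ennreal (exp (- h * s)) * \<dots> \<le> ennreal (exp (- h * s)) * (\<Prod>i\<in>I. ennreal (exp (v i)))"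
    using mgf by (intro mult_left_mono prod_mono_ennreal) auto
  also have "\<dots> = ennreal (exp (- h * s) * (\<Prod>i\<in>I. exp (v i)))"
    by (simp add: prod_ennreal prod_nonneg flip: ennreal_mult)
  also have "exp (- h * s) * (\<Prod>i\<in>I. exp (v i)) = exp (- (h * s) + (\<Sum>i\<in>I. v i))"
    by (simp add: exp_sum fin exp_diff exp_minus field_simps)
  also have "- (h * s) + (\<Sum>i\<in>I. v i) = - (h * s) + h\<^sup>2 * (\<Sum>i\<in>I. expectation (\<lambda>x. (U i x)\<^sup>2)) / 2
            + h ^ 3 * exp (h * b) * (\<Sum>i\<in>I. expectation (\<lambda>x. \<bar>U i x\<bar> ^ 3)) / 6"
    by (simp add: v_def sum.distrib sum_distrib_left sum_divide_distrib)
  finally show ?thesis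
    by (subst (asm) ennreal_le_iff) (simp_all add: m_def)
qed

subsection \<open>Tail bounds\<close>

lemma exp_neg_div_nonneg: "exp_neg_div t s \<ge> 0"
  by (simp add: exp_neg_div_def)

lemma exp_neg_div_mono:
  assumes "t \<ge> 0" "0 \<le> s" "s \<le> s'"
  shows "exp_neg_div t s \<le> exp_neg_div t s'"
  using assms by (auto simp: exp_neg_div_def intro!: divide_left_mono mult_pos_pos)

text \<open>From \<open>y \<le> exp y\<close> with \<open>y = t / s\<close>. A Gaussian term whose
  variance is a multiple of \<open>n P(|X| \<ge> c)\<close> thereby becomes linear in that
  quantity.\<close>

lemma exp_neg_div_le:
  assumes "t > 0" "s \<ge> 0"
  shows "exp_neg_div t s \<le> s / t"
proof (cases "s = 0")
  case False
  then have "t / s > 0" using assms by simp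
  moreover have "t / s \<le> exp (t / s)"
    using exp_ge_add_one_self[of "t / s"] by linarith
  ultimately have "inverse (exp (t / s)) \<le> inverse (t / s)"
    by (intro le_imp_inverse_le)
  then show ?thesis using False by (simp add: exp_neg_div_def exp_minus)
qed (simp add: exp_neg_div_def)

text \<open>The sum is at most twice the larger summand. This separates the two sources of variance,
  the truncated second moment and the mass placed at the cap, which are summed by different
  hypotheses.\<close>

lemma exp_neg_div_add_le:
  assumes "t \<ge> 0" "s1 \<ge> 0" "s2 \<ge> 0"
  shows "exp_neg_div t (s1 + s2) \<le> exp_neg_div t (2 * s1) + exp_neg_div t (2 * s2)"
proof (cases "s1 \<le> s2")
  case True
  then have "exp_neg_div t (s1 + s2) \<le> exp_neg_div t (2 * s2)"
    using assms by (intro exp_neg_div_mono) auto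
  then show ?thesis using exp_neg_div_nonneg[of t "2 * s1"] by linarith
next
  case False
  then have "exp_neg_div t (s1 + s2) \<le> exp_neg_div t (2 * s1)"
    using assms by (intro exp_neg_div_mono) auto
  then show ?thesis using exp_neg_div_nonneg[of t "2 * s2"] by linarith
qed

text \<open>The parameter of the exponential bound is limited by two constraints, one from the
  variance and one from the third moments; each term on the right arises when the corresponding
  constraint is the active one. A bound \<open>b\<close> small compared with \<open>s\<close> makes
  the exponent of the power large.\<close>

lemma (in prob_space) prob_sum_ge_le_Fuk_Nagaev:
  fixes U :: "'i \<Rightarrow> 'a \<Rightarrow> real"
  assumes fin: "finite I" and indep: "indep_vars (\<lambda>_. borel) U I"
    and bounded: "\<And>i x. i \<in> I \<Longrightarrow> \<bar>U i x\<bar> \<le> b" and b: "b > 0" and s: "s > 0"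
    and V: "(\<Sum>i\<in>I. expectation (\<lambda>x. (U i x)\<^sup>2)) \<le> V" "V > 0"
    and R: "(\<Sum>i\<in>I. expectation (\<lambda>x. \<bar>U i x\<bar> ^ 3)) \<le> R" "R > 0"
  shows "prob {x \<in> space M. (\<Sum>i\<in>I. U i x) - (\<Sum>i\<in>I. expectation (U i)) \<ge> s}
    \<le> exp (- (s\<^sup>2 / (4 * V))) + (4 * R / (3 * s * b\<^sup>2)) powr (s / (4 * b))"
proof -
  define r where "r = 4 * R / (3 * s * b\<^sup>2)"
  have r0: "r > 0" using R s b by (simp add: r_def)
  show ?thesis
  \<comment> \<open>If \<open>r < 1\<close>, the parameter \<open>h\<close> is chosen so that the quadratic and the cubic term of
    the exponent are each at most \<open>h s / 4\<close>.\<close>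
  proof (cases "r \<ge> 1")
    case True
    then have "r powr (s / (4 * b)) \<ge> 1" using s b by (intro ge_one_powr_ge_zero) auto
    then have "1 \<le> exp (- (s\<^sup>2 / (4 * V))) + r powr (s / (4 * b))"
      by (simp add: add_increasing)
    then show ?thesis unfolding r_def by (rule order_trans[OF prob_le_1])
  next
    case False
    define h where "h = min (s / (2 * V)) (- ln r / (2 * b))"
    have ln_r: "ln r < 0" using False r0 by simp
    then have h: "h > 0" using s V b by (simp add: h_def divide_neg_pos)
    have "h \<le> s / (2 * V)" by (simp add: h_def)
    then have hV: "h * V \<le> s / 2" using V by (simp add: field_simps)
    have "h \<le> - ln r / (2 * b)" unfolding h_def by (rule min.cobounded2)
    then have "2 * (h * b) \<le> - ln r" using b by (simp add: field_simps)
    then have "exp (2 * (h * b)) \<le> exp (- ln r)" by simp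
    then have exp_hb: "exp (2 * (h * b)) \<le> 1 / r" using r0 by (simp add: exp_minus inverse_eq_divide)
    have quad: "h\<^sup>2 * V / 2 \<le> h * s / 4"
      using mult_left_mono[OF hV, of "h / 2"] h by (simp add: power2_eq_square)
    \<comment> \<open>The factor \<open>h\<^sup>2\<close> of the cubic term is traded for a second
      exponential, so that the bound \<open>exp_hb\<close> on \<open>exp (2 * (h * b))\<close>
      controls the product. The constants in \<open>r\<close> are set up for this.\<close>
    have "(h * b)\<^sup>2 / 2 \<le> exp (h * b)"
      using exp_lower_Taylor_quadratic[of "h * b"] h b by (smt (verit) mult_nonneg_nonneg)
    then have "h\<^sup>2 * exp (h * b) \<le> 2 * exp (h * b) / b\<^sup>2 * exp (h * b)"
      using b by (intro mult_right_mono) (simp_all add: field_simps power_mult_distrib)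
    also have "\<dots> = 2 * exp (2 * (h * b)) / b\<^sup>2"
      by (simp add: mult_exp_exp)
    also have "\<dots> \<le> 2 * (1 / r) / b\<^sup>2"
      using exp_hb by (intro divide_right_mono mult_left_mono) auto
    also have "\<dots> = 3 * s / (2 * R)"
      using b s R by (simp add: r_def field_simps)
    finally have "h\<^sup>2 * exp (h * b) * R \<le> 3 * s / 2"
      using R by (simp add: field_simps)
    then have cub: "h ^ 3 * exp (h * b) * R / 6 \<le> h * s / 4"
      using mult_left_mono[of "h\<^sup>2 * exp (h * b) * R" "3 * s / 2" "h / 6"] h
      by (simp add: power2_eq_square power3_eq_cube mult_ac)
    have "prob {x \<in> space M. (\<Sum>i\<in>I. U i x) - (\<Sum>i\<in>I. expectation (U i)) \<ge> s}
      \<le> exp (- (h * s) + h\<^sup>2 * (\<Sum>i\<in>I. expectation (\<lambda>x. (U i x)\<^sup>2)) / 2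
            + h ^ 3 * exp (h * b) * (\<Sum>i\<in>I. expectation (\<lambda>x. \<bar>U i x\<bar> ^ 3)) / 6)"
      using assms h by (intro prob_sum_ge_le_exp) auto
    also have "\<dots> \<le> exp (- (h * s) + h\<^sup>2 * V / 2 + h ^ 3 * exp (h * b) * R / 6)"
      using V R h by (intro exp_le_cancel_iff[THEN iffD2] add_mono divide_right_mono mult_left_mono) auto
    also have "\<dots> \<le> exp (- (h * s / 2))" using quad cub by (intro exp_le_cancel_iff[THEN iffD2]) linarith
    also have "\<dots> \<le> exp (- (s\<^sup>2 / (4 * V))) + r powr (s / (4 * b))"
    \<comment> \<open>Which entry of the minimum defining \<open>h\<close> is attained decides which
      of the two terms bounds the exponential.\<close>
    proof (cases "s / (2 * V) \<le> - ln r / (2 * b)")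
      case True
      then have "h * s / 2 = s\<^sup>2 / (4 * V)" by (simp add: h_def power2_eq_square)
      then show ?thesis by simp
    next
      case False
      then have "- (h * s / 2) = s / (4 * b) * ln r" by (simp add: h_def min_def)
      then have "exp (- (h * s / 2)) = r powr (s / (4 * b))" using r0 by (simp add: powr_def)
      then show ?thesis by simp
    qed
    finally show ?thesis unfolding r_def .
  qed
qed

text \<open>The one-sided bound is applied to \<open>U\<close> and to its negative. If
  \<open>V\<close> or \<open>R\<close> is 0, the second or third absolute moments vanish, every
  \<open>U i\<close> is 0 almost surely, and the probability is 0; this matches the convention built
  into \<open>exp_neg_div\<close>.\<close>

lemma (in prob_space) prob_abs_sum_ge_le_Fuk_Nagaev:
  fixes U :: "'i \<Rightarrow> 'a \<Rightarrow> real"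
  assumes fin: "finite I" and indep: "indep_vars (\<lambda>_. borel) U I"
    and bounded: "\<And>i x. i \<in> I \<Longrightarrow> \<bar>U i x\<bar> \<le> b" and b: "b > 0" and s: "s > 0"
    and V: "(\<Sum>i\<in>I. expectation (\<lambda>x. (U i x)\<^sup>2)) \<le> V"
    and R: "(\<Sum>i\<in>I. expectation (\<lambda>x. \<bar>U i x\<bar> ^ 3)) \<le> R"
  shows "prob {x \<in> space M. \<bar>(\<Sum>i\<in>I. U i x) - (\<Sum>i\<in>I. expectation (U i))\<bar> \<ge> s}
    \<le> 2 * (exp_neg_div (s\<^sup>2) (4 * V) + (4 * R / (3 * s * b\<^sup>2)) powr (s / (4 * b)))"
proof -
  define Z where "Z x = (\<Sum>i\<in>I. U i x) - (\<Sum>i\<in>I. expectation (U i))" for x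
  have U_meas: "U i \<in> borel_measurable M" if "i \<in> I" for i
    using indep that by (auto simp: indep_vars_def)
  have Z_meas[measurable]: "Z \<in> borel_measurable M"
    unfolding Z_def using U_meas by (intro borel_measurable_diff borel_measurable_sum) auto
  have int: "integrable M (\<lambda>x. \<bar>U i x\<bar> ^ p)" if i: "i \<in> I" for i p
  proof -
    note [measurable] = U_meas[OF i]
    have "\<bar>U i x\<bar> ^ p \<le> b ^ p" for x
      using bounded[OF i] by (intro power_mono) auto
    then show ?thesis by (intro integrable_const_bound[where B="b ^ p"]) auto
  qed
  have sum_nonneg: "(\<Sum>i\<in>I. expectation (\<lambda>x. \<bar>U i x\<bar> ^ p)) \<ge> 0" for p
    by (intro sum_nonneg integral_nonneg) auto
  have V0: "V \<ge> 0" using sum_nonneg[of 2] V by simp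
  have R0: "R \<ge> 0" using sum_nonneg[of 3] R by simp
  show ?thesis
  proof (cases "V > 0 \<and> R > 0")
    case True
    have "prob {x \<in> space M. \<bar>Z x\<bar> \<ge> s} \<le> prob ({x \<in> space M. Z x \<ge> s} \<union> {x \<in> space M. - Z x \<ge> s})"
      by (intro finite_measure_mono) auto
    also have "\<dots> \<le> prob {x \<in> space M. Z x \<ge> s} + prob {x \<in> space M. - Z x \<ge> s}"
      by (intro measure_Un_le) auto
    also have "prob {x \<in> space M. Z x \<ge> s}
        \<le> exp (- (s\<^sup>2 / (4 * V))) + (4 * R / (3 * s * b\<^sup>2)) powr (s / (4 * b))"
      unfolding Z_def using assms True by (intro prob_sum_ge_le_Fuk_Nagaev) auto
    also have "prob {x \<in> space M. - Z x \<ge> s}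
        \<le> exp (- (s\<^sup>2 / (4 * V))) + (4 * R / (3 * s * b\<^sup>2)) powr (s / (4 * b))"
    proof -
      have "- Z x = (\<Sum>i\<in>I. - U i x) - (\<Sum>i\<in>I. expectation (\<lambda>x. - U i x))" for x
        by (simp add: Z_def sum_negf)
      moreover have "indep_vars (\<lambda>_. borel) (\<lambda>i x. - U i x) I"
        by (rule indep_vars_compose2[OF indep]) auto
      ultimately show ?thesis
        using prob_sum_ge_le_Fuk_Nagaev[OF fin, of "\<lambda>i x. - U i x" b s V R] bounded b s V R True by simp
    qed
    finally show ?thesis using True by (simp add: Z_def exp_neg_div_def)
  next
    case False
    have "\<exists>p>0. (\<Sum>i\<in>I. expectation (\<lambda>x. \<bar>U i x\<bar> ^ p)) \<le> 0"
    proof (cases "V > 0")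
      case True
      then show ?thesis using False R by (intro exI[of _ 3]) auto
    next
      case False
      then show ?thesis using V by (intro exI[of _ 2]) auto
    qed
    then obtain p where p: "p > 0" "(\<Sum>i\<in>I. expectation (\<lambda>x. \<bar>U i x\<bar> ^ p)) = 0"
      using sum_nonneg by (auto intro: antisym)
    have AE0: "AE x in M. U i x = 0" if i: "i \<in> I" for i
    proof -
      have "expectation (\<lambda>x. \<bar>U i x\<bar> ^ p) = 0"
        using p(2) i fin by (subst (asm) sum_nonneg_eq_0_iff) (auto intro!: integral_nonneg)
      then have "AE x in M. \<bar>U i x\<bar> ^ p = 0"
        using int[OF i] by (subst (asm) integral_nonneg_eq_0_iff_AE) auto
      then show ?thesis using p(1) by simp
    qed
    have "expectation (U i) = 0" if "i \<in> I" for i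
      using AE0[OF that] by (simp cong: integral_cong_AE add: integral_eq_zero_AE)
    moreover have "AE x in M. \<forall>i\<in>I. U i x = 0"
      using AE0 fin by (intro AE_finite_allI)
    ultimately have "AE x in M. Z x = 0"
      unfolding Z_def by (auto elim: eventually_mono)
    then have "AE x in M. x \<notin> {x \<in> space M. \<bar>Z x\<bar> \<ge> s}"
      using s by (auto elim: eventually_mono)
    then have "prob {x \<in> space M. \<bar>Z x\<bar> \<ge> s} = 0"
      by (subst prob_eq_0) auto
    then show ?thesis
      unfolding Z_def using exp_neg_div_nonneg by (simp add: add_nonneg_nonneg)
  qed
qed

text \<open>In the application \<open>S'\<close> is the truncated sum and \<open>m\<close> its mean,
  on which there is no direct control. Either the right side is at least 1, or \<open>m\<close> lies
  within \<open>x\<close> of the median, hence \<open>\<bar>m\<bar> \<le> 2 * x\<close>, and then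
  \<open>\<bar>S\<bar> \<ge> 3 * x\<close> forces a deviation of at least \<open>x\<close> from
  \<open>m\<close>.\<close>

lemma (in prob_space) prob_ge_le_median:
  fixes S S' :: "'a \<Rightarrow> real"
  assumes [measurable]: "S \<in> borel_measurable M" "S' \<in> borel_measurable M"
    and med: "is_median M S \<mu>" and x: "x > 0"
  shows "prob {\<omega> \<in> space M. \<bar>S \<omega>\<bar> \<ge> 3 * x} \<le>
    2 * (prob {\<omega> \<in> space M. \<bar>S' \<omega> - m\<bar> \<ge> x} + prob {\<omega> \<in> space M. S \<omega> \<noteq> S' \<omega>})
    + (if \<bar>\<mu>\<bar> > x then 1 else 0)"
    (is "_ \<le> 2 * ?p + _")
proof -
  have p0: "?p \<ge> 0" by simp
  have le: "prob {\<omega> \<in> space M. P \<omega>} \<le> ?p"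
    if P: "\<And>\<omega>. P \<omega> \<Longrightarrow> \<bar>S \<omega> - m\<bar> \<ge> x" for P
  proof -
    have "prob {\<omega> \<in> space M. P \<omega>}
        \<le> prob ({\<omega> \<in> space M. \<bar>S' \<omega> - m\<bar> \<ge> x} \<union> {\<omega> \<in> space M. S \<omega> \<noteq> S' \<omega>})"
      using P by (intro finite_measure_mono) force+
    also have "\<dots> \<le> ?p" by (intro measure_Un_le) auto
    finally show ?thesis .
  qed
  show ?thesis
  proof (cases "?p \<ge> 1 / 2 \<or> \<bar>\<mu>\<bar> > x")
    case True
    then have "1 \<le> 2 * ?p + (if \<bar>\<mu>\<bar> > x then 1 else 0)" using p0 by auto
    then show ?thesis by (rule order_trans[OF prob_le_1])
  next
    case False
    have med': "prob {\<omega> \<in> space M. S \<omega> \<le> \<mu>} \<ge> 1 / 2" "prob {\<omega> \<in> space M. S \<omega> \<ge> \<mu>} \<ge> 1 / 2"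
      using med by (auto simp: is_median_def)
    have "\<bar>m - \<mu>\<bar> < x" \<comment> \<open>otherwise the deviation event contains one of the two median events\<close>
    proof (rule ccontr)
      assume "\<not> \<bar>m - \<mu>\<bar> < x"
      then consider "m \<ge> \<mu> + x" | "m \<le> \<mu> - x" by linarith
      then have "?p \<ge> 1 / 2"
      proof cases
        case 1
        show ?thesis by (rule order_trans[OF med'(1) le]) (use 1 in linarith)
      next
        case 2
        show ?thesis by (rule order_trans[OF med'(2) le]) (use 2 in linarith)
      qed
      with False show False by simp
    qed
    with False have "\<bar>m\<bar> \<le> 2 * x" by linarith
    then have "prob {\<omega> \<in> space M. \<bar>S \<omega>\<bar> \<ge> 3 * x} \<le> ?p"
      by (intro le) linarith
    with p0 show ?thesis by (smt (verit))
  qed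
qed

text \<open>The purpose is to have \<open>u\<close> enter linearly, since the tail hypothesis sums
  only the first power of \<open>n P(|X| \<ge> c)\<close>. For \<open>u \<ge> 1\<close> the cap by 1
  suffices; otherwise the exponent drops to \<theta>, the power of the sum is split, and
  \<open>u powr \<theta> \<le> u\<close>.\<close>

lemma min_1_powr_le:
  fixes D u r p \<theta> :: real
  assumes "D \<ge> 0" "u \<ge> 0" "0 \<le> r" "r \<le> D + u" "1 \<le> \<theta>" "\<theta> \<le> p"
  shows "min 1 (r powr p) \<le> 2 powr \<theta> * (D powr \<theta> + u)"
proof -
  have 2: "2 powr \<theta> \<ge> 1" using assms by (intro ge_one_powr_ge_zero) auto
  consider "u \<ge> 1" | "u < 1" by linarith
  then show ?thesis
  proof cases
    case 1
    then have "1 \<le> 2 powr \<theta> * (D powr \<theta> + u)"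
      using 2 mult_mono[of 1 "2 powr \<theta>" 1 "D powr \<theta> + u"] by (simp add: add_increasing)
    then show ?thesis by simp
  next
    case 2
    have "min 1 (r powr p) \<le> (D + u) powr \<theta>"
    proof (cases "D + u \<ge> 1")
      case True
      then have "1 \<le> (D + u) powr \<theta>" using assms by (intro ge_one_powr_ge_zero) auto
      then show ?thesis by simp
    next
      case False
      have "r powr p \<le> r powr \<theta>" using assms False by (intro powr_mono') auto
      also have "\<dots> \<le> (D + u) powr \<theta>" using assms by (intro powr_mono2) auto
      finally show ?thesis by simp
    qed
    also have "\<dots> \<le> (2 * max D u) powr \<theta>" using assms by (intro powr_mono2) auto
    also have "\<dots> = 2 powr \<theta> * max D u powr \<theta>" using assms by (simp add: powr_mult)
    also have "max D u powr \<theta> \<le> D powr \<theta> + u powr \<theta>" by (simp add: max_def)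
    also have "u powr \<theta> \<le> u"
      using powr_mono'[of 1 \<theta> u] assms 2 by simp
    finally show ?thesis by simp
  qed
qed

section \<open>Truncated and capped moments of the dominating variable\<close>

lemma truncated_moment_diff:
  fixes X :: "'a \<Rightarrow> real"
  assumes "prob_space N" and [measurable]: "X \<in> borel_measurable N" and c: "0 \<le> c" "c \<le> d"
  shows "(\<integral>\<omega>. \<bar>X \<omega>\<bar> ^ p * indicator {x. \<bar>x\<bar> < c} (X \<omega>) \<partial>N)
      \<le> (\<integral>\<omega>. \<bar>X \<omega>\<bar> ^ p * indicator {x. \<bar>x\<bar> < d} (X \<omega>) \<partial>N)" (is "?H c \<le> _")
    and "(\<integral>\<omega>. \<bar>X \<omega>\<bar> ^ p * indicator {x. \<bar>x\<bar> < d} (X \<omega>) \<partial>N)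
      - (\<integral>\<omega>. \<bar>X \<omega>\<bar> ^ p * indicator {x. \<bar>x\<bar> < c} (X \<omega>) \<partial>N)
      \<le> d ^ p * (\<P>(\<omega> in N. \<bar>X \<omega>\<bar> \<ge> c) - \<P>(\<omega> in N. \<bar>X \<omega>\<bar> \<ge> d))"
proof -
  interpret N: prob_space N by fact
  have int: "integrable N (\<lambda>\<omega>. \<bar>X \<omega>\<bar> ^ p * indicator {x. \<bar>x\<bar> < e} (X \<omega>))" if "e \<ge> 0" for e
  proof (intro N.integrable_const_bound[where B="e ^ p"] AE_I2)
    fix \<omega> show "norm (\<bar>X \<omega>\<bar> ^ p * indicator {x. \<bar>x\<bar> < e} (X \<omega>)) \<le> e ^ p"
      using that by (auto simp: indicator_def intro!: power_mono)
  qed measurable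
  have ind: "integrable N (indicat_real {\<omega> \<in> space N. \<bar>X \<omega>\<bar> \<ge> e})" for e
    by (intro integrable_real_indicator) (auto simp: less_top[symmetric])
  have d: "d \<ge> 0" using c by simp
  show "?H c \<le> ?H d"
    using c by (intro integral_mono int) (auto simp: indicator_def)
  \<comment> \<open>The two truncations differ only on the shell from \<open>c\<close> to
    \<open>d\<close>, where the power is at most \<open>d ^ p\<close>; the difference of the two
    indicators is the indicator of that shell.\<close>
  have "?H d \<le> (\<integral>\<omega>. \<bar>X \<omega>\<bar> ^ p * indicator {x. \<bar>x\<bar> < c} (X \<omega>)
      + d ^ p * (indicator {\<omega> \<in> space N. \<bar>X \<omega>\<bar> \<ge> c} \<omega> - indicator {\<omega> \<in> space N. \<bar>X \<omega>\<bar> \<ge> d} \<omega>) \<partial>N)"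
  proof (intro integral_mono int d)
    show "integrable N (\<lambda>\<omega>. \<bar>X \<omega>\<bar> ^ p * indicator {x. \<bar>x\<bar> < c} (X \<omega>)
      + d ^ p * (indicator {\<omega> \<in> space N. \<bar>X \<omega>\<bar> \<ge> c} \<omega> - indicator {\<omega> \<in> space N. \<bar>X \<omega>\<bar> \<ge> d} \<omega>))"
      using int[OF c(1)] ind by (intro Bochner_Integration.integrable_add
        Bochner_Integration.integrable_diff integrable_mult_right)
  qed (use c in \<open>auto simp: indicator_def intro!: power_mono\<close>)
  also have "\<dots> = ?H c + d ^ p * (\<P>(\<omega> in N. \<bar>X \<omega>\<bar> \<ge> c) - \<P>(\<omega> in N. \<bar>X \<omega>\<bar> \<ge> d))"
    using int[OF c(1)] ind by simp
  finally show "?H d - ?H c \<le> d ^ p * (\<P>(\<omega> in N. \<bar>X \<omega>\<bar> \<ge> c) - \<P>(\<omega> in N. \<bar>X \<omega>\<bar> \<ge> d))"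
    by simp
qed

lemma expectation_min_power:
  fixes X :: "'a \<Rightarrow> real"
  assumes "prob_space N" and [measurable]: "X \<in> borel_measurable N" and c: "c \<ge> 0"
  shows "(\<integral>\<omega>. min \<bar>X \<omega>\<bar> c ^ p \<partial>N) =
    (\<integral>\<omega>. \<bar>X \<omega>\<bar> ^ p * indicator {x. \<bar>x\<bar> < c} (X \<omega>) \<partial>N) + c ^ p * \<P>(\<omega> in N. \<bar>X \<omega>\<bar> \<ge> c)"
proof -
  interpret N: prob_space N by fact
  have int: "integrable N (\<lambda>\<omega>. \<bar>X \<omega>\<bar> ^ p * indicator {x. \<bar>x\<bar> < c} (X \<omega>))"
  proof (intro N.integrable_const_bound[where B="c ^ p"] AE_I2)
    fix \<omega> show "norm (\<bar>X \<omega>\<bar> ^ p * indicator {x. \<bar>x\<bar> < c} (X \<omega>)) \<le> c ^ p"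
      using c by (auto simp: indicator_def intro!: power_mono)
  qed measurable
  have ind: "integrable N (indicat_real {\<omega> \<in> space N. \<bar>X \<omega>\<bar> \<ge> c})"
    by (intro integrable_real_indicator) (auto simp: less_top[symmetric])
  have "(\<integral>\<omega>. min \<bar>X \<omega>\<bar> c ^ p \<partial>N) = (\<integral>\<omega>. \<bar>X \<omega>\<bar> ^ p * indicator {x. \<bar>x\<bar> < c} (X \<omega>)
      + c ^ p * indicator {\<omega> \<in> space N. \<bar>X \<omega>\<bar> \<ge> c} \<omega> \<partial>N)"
    by (intro Bochner_Integration.integral_cong) (auto simp: indicator_def min_def)
  then show ?thesis using int ind by simp
qed

text \<open>The two-sided bound above, with the moments of the truncated variables compared to
  capped moments of \<open>X\<close>. The cap adds \<open>c ^ p * q\<close> to the truncated moment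
  of \<open>X\<close>: for \<open>p = 2\<close> this part is split off the Gaussian term and becomes
  linear in \<open>q\<close>, for \<open>p = 3\<close> it stays in the base of the power.\<close>

lemma prob_truncated_sum_deviation_le:
  fixes Y :: "nat \<Rightarrow> 'b \<Rightarrow> real" and X :: "'a \<Rightarrow> real"
  assumes M: "prob_space M" and N: "prob_space N" and X: "X \<in> borel_measurable N"
    and indep: "prob_space.indep_vars M (\<lambda>_. borel) Y {1..n}"
    and n: "n \<ge> 1" and dom: "weakly_mean_dominated K M n Y N X" and c: "c > 0" and s: "s > 0"
  defines "U \<equiv> \<lambda>k \<omega>. Y k \<omega> * indicator {y. \<bar>y\<bar> < c} (Y k \<omega>)"
    and "q \<equiv> \<P>(\<omega> in N. \<bar>X \<omega>\<bar> \<ge> c)"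
    and "H \<equiv> \<integral>\<omega>. \<bar>X \<omega>\<bar> ^ 3 * indicator {x. \<bar>x\<bar> < c} (X \<omega>) \<partial>N"
  shows "\<P>(\<omega> in M. \<bar>(\<Sum>k=1..n. U k \<omega>) - (\<Sum>k=1..n. \<integral>\<omega>. U k \<omega> \<partial>M)\<bar> \<ge> s)
    \<le> 2 * (exp_neg_div (s\<^sup>2) (8 * K * (real n * truncated_second_moment N X c))
         + 8 * K * (c / s)\<^sup>2 * (real n * q)
         + (4 * K * c / (3 * s) * (real n * H / c ^ 3 + real n * q)) powr (s / (4 * c)))"
proof -
  interpret M: prob_space M by fact
  interpret N: prob_space N by fact
  define T where "T = truncated_second_moment N X c"
  have K: "K \<ge> 1" using weakly_mean_dominated_const_ge_1[OF M N n dom] .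
  have Y: "Y k \<in> borel_measurable M" if "k \<in> {1..n}" for k
    using indep that by (auto simp: M.indep_vars_def)
  have q0: "q \<ge> 0" by (simp add: q_def)
  have T0: "T \<ge> 0" by (auto simp: T_def truncated_second_moment_def)
  have T_eq: "T = (\<integral>\<omega>. \<bar>X \<omega>\<bar> ^ 2 * indicator {x. \<bar>x\<bar> < c} (X \<omega>) \<partial>N)"
    by (simp add: T_def truncated_second_moment_def)
  have indep_U: "M.indep_vars (\<lambda>_. borel) U {1..n}"
    unfolding U_def by (rule M.indep_vars_compose2[OF indep]) auto
  have U_bounded: "\<bar>U k \<omega>\<bar> \<le> c" for k \<omega>
    using c by (auto simp: U_def indicator_def)
  have moment: "(\<Sum>k=1..n. \<integral>\<omega>. \<bar>U k \<omega>\<bar> ^ p \<partial>M)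
      \<le> real n * K * ((\<integral>\<omega>. \<bar>X \<omega>\<bar> ^ p * indicator {x. \<bar>x\<bar> < c} (X \<omega>) \<partial>N) + c ^ p * q)"
    if p: "p > 0" for p
  proof -
    have "(\<Sum>k=1..n. \<integral>\<omega>. \<bar>U k \<omega>\<bar> ^ p \<partial>M) \<le> (\<Sum>k=1..n. \<integral>\<omega>. min \<bar>Y k \<omega>\<bar> c ^ p \<partial>M)"
    proof (intro sum_mono integral_mono)
      fix k assume "k \<in> {1..n}"
      note [measurable] = Y[OF this]
      show "integrable M (\<lambda>\<omega>. min \<bar>Y k \<omega>\<bar> c ^ p)"
        using c by (intro M.integrable_const_bound[where B="c ^ p"]) (auto intro!: power_mono)
      have [measurable]: "U k \<in> borel_measurable M" unfolding U_def by measurable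
      show "integrable M (\<lambda>\<omega>. \<bar>U k \<omega>\<bar> ^ p)"
        using U_bounded by (intro M.integrable_const_bound[where B="c ^ p"]) (auto intro!: power_mono)
      show "\<bar>U k \<omega>\<bar> ^ p \<le> min \<bar>Y k \<omega>\<bar> c ^ p" for \<omega>
        using c p by (intro power_mono) (auto simp: U_def indicator_def)
    qed
    also have "\<dots> \<le> real n * K * (\<integral>\<omega>. min \<bar>X \<omega>\<bar> c ^ p \<partial>N)"
      using c p by (intro sum_expectation_min_power_le M N Y X n dom) auto
    also have "(\<integral>\<omega>. min \<bar>X \<omega>\<bar> c ^ p \<partial>N)
        = (\<integral>\<omega>. \<bar>X \<omega>\<bar> ^ p * indicator {x. \<bar>x\<bar> < c} (X \<omega>) \<partial>N) + c ^ p * q"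
      unfolding q_def using c by (intro expectation_min_power N X) auto
    finally show ?thesis .
  qed
  have V: "(\<Sum>k=1..n. \<integral>\<omega>. (U k \<omega>)\<^sup>2 \<partial>M) \<le> real n * K * (T + c\<^sup>2 * q)"
    using moment[of 2] by (simp add: T_eq)
  have R: "(\<Sum>k=1..n. \<integral>\<omega>. \<bar>U k \<omega>\<bar> ^ 3 \<partial>M) \<le> real n * K * (H + c ^ 3 * q)"
    using moment[of 3] by (simp add: H_def)
  have "\<P>(\<omega> in M. \<bar>(\<Sum>k=1..n. U k \<omega>) - (\<Sum>k=1..n. \<integral>\<omega>. U k \<omega> \<partial>M)\<bar> \<ge> s)
    \<le> 2 * (exp_neg_div (s\<^sup>2) (4 * (real n * K * (T + c\<^sup>2 * q)))
         + (4 * (real n * K * (H + c ^ 3 * q)) / (3 * s * c\<^sup>2)) powr (s / (4 * c)))"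
    using U_bounded by (intro M.prob_abs_sum_ge_le_Fuk_Nagaev indep_U c s V R) auto
  also have "4 * (real n * K * (H + c ^ 3 * q)) / (3 * s * c\<^sup>2)
      = 4 * K * c / (3 * s) * (real n * H / c ^ 3 + real n * q)"
    using c s by (simp add: field_simps power2_eq_square power3_eq_cube)
  also have "exp_neg_div (s\<^sup>2) (4 * (real n * K * (T + c\<^sup>2 * q)))
      = exp_neg_div (s\<^sup>2) (4 * K * (real n * T) + 4 * K * c\<^sup>2 * (real n * q))"
    by (simp add: algebra_simps)
  also have "\<dots> \<le> exp_neg_div (s\<^sup>2) (2 * (4 * K * (real n * T)))
      + exp_neg_div (s\<^sup>2) (2 * (4 * K * c\<^sup>2 * (real n * q)))"
    using K T0 q0 by (intro exp_neg_div_add_le) auto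
  also have "exp_neg_div (s\<^sup>2) (2 * (4 * K * c\<^sup>2 * (real n * q)))
      \<le> 2 * (4 * K * c\<^sup>2 * (real n * q)) / s\<^sup>2"
    using K q0 s by (intro exp_neg_div_le) auto
  finally show ?thesis by (simp add: T_def power_divide mult_ac)
qed

lemma prob_sum_neq_truncated_sum_le:
  fixes Y :: "nat \<Rightarrow> 'b \<Rightarrow> real" and X :: "'a \<Rightarrow> real"
  assumes M: "prob_space M" and Y: "\<And>k. k \<in> {1..n} \<Longrightarrow> Y k \<in> borel_measurable M"
    and n: "n \<ge> 1" and dom: "weakly_mean_dominated K M n Y N X"
  shows "\<P>(\<omega> in M. (\<Sum>k=1..n. Y k \<omega>) \<noteq> (\<Sum>k=1..n. Y k \<omega> * indicator {y. \<bar>y\<bar> < c} (Y k \<omega>)))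
    \<le> K * (real n * \<P>(\<omega> in N. \<bar>X \<omega>\<bar> \<ge> c))"
proof -
  interpret M: prob_space M by fact
  have ms: "{\<omega> \<in> space M. \<bar>Y k \<omega>\<bar> \<ge> c} \<in> sets M" if "k \<in> {1..n}" for k
  proof -
    note [measurable] = Y[OF that]
    show ?thesis by measurable
  qed
  have "M.prob {\<omega> \<in> space M. (\<Sum>k=1..n. Y k \<omega>) \<noteq> (\<Sum>k=1..n. Y k \<omega> * indicator {y. \<bar>y\<bar> < c} (Y k \<omega>))}
    \<le> M.prob (\<Union>k\<in>{1..n}. {\<omega> \<in> space M. \<bar>Y k \<omega>\<bar> \<ge> c})"
  proof (rule M.finite_measure_mono)
    show "(\<Union>k\<in>{1..n}. {\<omega> \<in> space M. \<bar>Y k \<omega>\<bar> \<ge> c}) \<in> sets M"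
      using ms by (intro sets.finite_UN) auto
    show "{\<omega> \<in> space M. (\<Sum>k=1..n. Y k \<omega>) \<noteq> (\<Sum>k=1..n. Y k \<omega> * indicator {y. \<bar>y\<bar> < c} (Y k \<omega>))}
      \<subseteq> (\<Union>k\<in>{1..n}. {\<omega> \<in> space M. \<bar>Y k \<omega>\<bar> \<ge> c})"
    proof (intro subsetI, rule ccontr)
      fix \<omega>
      assume \<omega>: "\<omega> \<in> {\<omega> \<in> space M. (\<Sum>k=1..n. Y k \<omega>) \<noteq> (\<Sum>k=1..n. Y k \<omega> * indicator {y. \<bar>y\<bar> < c} (Y k \<omega>))}"
        "\<omega> \<notin> (\<Union>k\<in>{1..n}. {\<omega> \<in> space M. \<bar>Y k \<omega>\<bar> \<ge> c})"
      then have "(\<Sum>k=1..n. Y k \<omega>) = (\<Sum>k=1..n. Y k \<omega> * indicator {y. \<bar>y\<bar> < c} (Y k \<omega>))"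
        by (intro sum.cong) (auto simp: indicator_def not_le)
      with \<omega>(1) show False by blast
    qed
  qed
  also have "\<dots> \<le> (\<Sum>k=1..n. M.prob {\<omega> \<in> space M. \<bar>Y k \<omega>\<bar> \<ge> c})"
    using ms by (intro M.finite_measure_subadditive_finite) auto
  also have "\<dots> \<le> K * (real n * \<P>(\<omega> in N. \<bar>X \<omega>\<bar> \<ge> c))"
    using dom[unfolded weakly_mean_dominated_def, rule_format, of c] n by (simp add: field_simps)
  finally show ?thesis .
qed

text \<open>The truncation level \<open>\<delta> \<alpha>\<close> is a small enough fraction of the deviation \<open>\<eta> \<alpha>\<close> that the
  exponent of the power term is at least \<open>\<theta>\<close>, its base loses the constant \<open>K\<close>, and the
  Gaussian term is absorbed by the one with \<open>\<delta>\<close> in place of \<open>\<eta>\<close>.\<close>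

lemma prob_sum_ge_le:
  fixes Y :: "nat \<Rightarrow> 'b \<Rightarrow> real" and X :: "'a \<Rightarrow> real" and \<theta> \<eta> \<alpha> K :: real
  assumes M: "prob_space M" and N: "prob_space N" and X: "X \<in> borel_measurable N"
    and indep: "prob_space.indep_vars M (\<lambda>_. borel) Y {1..n}"
    and n: "n \<ge> 1" and dom: "weakly_mean_dominated K M n Y N X"
    and med: "is_median M (\<lambda>\<omega>. \<Sum>k=1..n. Y k \<omega>) \<mu>"
    and \<alpha>: "\<alpha> > 0" and \<eta>: "\<eta> > 0" and \<theta>: "\<theta> \<ge> 1"
  defines "\<delta> \<equiv> \<eta> / (8 * K * \<theta>)"
  defines "q \<equiv> \<P>(\<omega> in N. \<bar>X \<omega>\<bar> \<ge> \<delta> * \<alpha>)"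
    and "H \<equiv> (\<integral>\<omega>. \<bar>X \<omega>\<bar> ^ 3 * indicator {x. \<bar>x\<bar> < \<delta> * \<alpha>} (X \<omega>) \<partial>N) / \<delta> ^ 3"
  shows "\<P>(\<omega> in M. \<bar>\<Sum>k=1..n. Y k \<omega>\<bar> \<ge> 3 * \<eta> * \<alpha>)
    \<le> 4 * exp_neg_div (\<delta>\<^sup>2 * \<alpha>\<^sup>2) (real n * truncated_second_moment N X (\<delta> * \<alpha>))
      + (4 + 4 * 2 powr \<theta> + 2 * K) * (real n * q)
      + 4 * 2 powr \<theta> * (real n * H / \<alpha> ^ 3) powr \<theta>
      + (if \<bar>\<mu>\<bar> > \<eta> * \<alpha> then 1 else 0)"
proof -
  interpret M: prob_space M by fact
  interpret N: prob_space N by fact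
  have K: "K \<ge> 1" using weakly_mean_dominated_const_ge_1[OF M N n dom] .
  have Y: "Y k \<in> borel_measurable M" if "k \<in> {1..n}" for k
    using indep that by (auto simp: M.indep_vars_def)
  define c s u where "c = \<delta> * \<alpha>" and "s = \<eta> * \<alpha>" and "u = real n * q"
  define T where "T = truncated_second_moment N X c"
  define D where "D = real n * H / \<alpha> ^ 3"
  define U where "U k \<omega> = Y k \<omega> * indicator {y. \<bar>y\<bar> < c} (Y k \<omega>)" for k \<omega>
  define m where "m = (\<Sum>k=1..n. \<integral>\<omega>. U k \<omega> \<partial>M)"
  define P where "P = M.prob {\<omega> \<in> space M. \<bar>(\<Sum>k=1..n. U k \<omega>) - m\<bar> \<ge> s}"
  define r where "r = 4 * K * c / (3 * s) * (D + u)"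
  have \<delta>: "\<delta> > 0" using K \<theta> \<eta> by (simp add: \<delta>_def)
  have c: "c > 0" and s: "s > 0" using \<alpha> \<delta> \<eta> by (simp_all add: c_def s_def)
  have T0: "T \<ge> 0" by (auto simp: T_def truncated_second_moment_def)
  have u0: "u \<ge> 0" by (simp add: u_def q_def)
  have D0: "D \<ge> 0" using \<delta> \<alpha> unfolding D_def H_def by auto
  have cs: "c / s = 1 / (8 * K * \<theta>)" using \<alpha> \<eta> by (simp add: c_def s_def \<delta>_def)
  have K\<theta>: "K * \<theta> \<ge> K" using K \<theta> by simp
  have K\<theta>2: "K * \<theta> \<ge> \<theta>" using K \<theta> by simp
  \<comment> \<open>By \<open>cs\<close> the left side is \<open>8 * K * (c / s)\<^sup>2\<close>.
    The bound serves twice: to compare the Gaussian terms and to remove the coefficient of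
    \<open>u\<close>.\<close>
  have K\<theta>3: "8 * K / (8 * K * \<theta>)\<^sup>2 \<le> 1"
  proof -
    have "8 * K \<le> 8 * K * \<theta>" using K\<theta> by simp
    also have "\<dots> \<le> (8 * K * \<theta>)\<^sup>2" using K K\<theta> by (intro self_le_power) linarith+
    finally show ?thesis using K \<theta> by (simp add: divide_le_eq)
  qed
  have "P \<le> 2 * (exp_neg_div (s\<^sup>2) (8 * K * (real n * T)) + 8 * K * (c / s)\<^sup>2 * u + r powr (s / (4 * c)))"
  proof -
    have "real n * (\<integral>\<omega>. \<bar>X \<omega>\<bar> ^ 3 * indicator {x. \<bar>x\<bar> < c} (X \<omega>) \<partial>N) / c ^ 3 = D"
      by (simp add: D_def H_def c_def power_mult_distrib)
    then show ?thesis
      using prob_truncated_sum_deviation_le[OF M N X indep n dom c s]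
      by (simp add: P_def m_def U_def T_def u_def q_def r_def c_def)
  qed
  \<comment> \<open>Since \<open>P\<close> is a probability, the power term may be capped at 1, the
    form that \<open>min_1_powr_le\<close> needs.\<close>
  moreover have "P \<le> 1" by (simp add: P_def)
  moreover have "exp_neg_div (s\<^sup>2) (8 * K * (real n * T)) \<ge> 0" by (rule exp_neg_div_nonneg)
  moreover have "8 * K * (c / s)\<^sup>2 * u \<ge> 0" using K u0 by auto
  ultimately have "P \<le> 2 * (exp_neg_div (s\<^sup>2) (8 * K * (real n * T)) + 8 * K * (c / s)\<^sup>2 * u
      + min 1 (r powr (s / (4 * c))))"
    by (smt (verit))
  also have "exp_neg_div (s\<^sup>2) (8 * K * (real n * T)) \<le> exp_neg_div (\<delta>\<^sup>2 * \<alpha>\<^sup>2) (real n * T)"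
  proof (cases "T = 0")
    case True
    then show ?thesis by (simp add: exp_neg_div_def)
  next
    case False
    then have T: "real n * T > 0" using T0 n by simp
    have "c\<^sup>2 * (8 * K) \<le> s\<^sup>2"
    proof -
      have "c = s / (8 * K * \<theta>)" using cs s by (simp add: field_simps)
      then have "c\<^sup>2 * (8 * K) = s\<^sup>2 * (8 * K / (8 * K * \<theta>)\<^sup>2)" by (simp add: power_divide)
      also note K\<theta>3
      finally show ?thesis by (simp add: mult_left_mono)
    qed
    then have "c\<^sup>2 / (real n * T) \<le> s\<^sup>2 / (8 * K * (real n * T))"
      using T K by (simp add: field_simps)
    then show ?thesis using T K by (simp add: exp_neg_div_def c_def power_mult_distrib)
  qed
  also have "8 * K * (c / s)\<^sup>2 * u \<le> u"
  proof -
    have "8 * K * (c / s)\<^sup>2 = 8 * K / (8 * K * \<theta>)\<^sup>2" by (simp add: cs power_divide)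
    also note K\<theta>3
    finally show ?thesis using u0 mult_right_mono[of _ 1 u] by simp
  qed
  also have "min 1 (r powr (s / (4 * c))) \<le> 2 powr \<theta> * (D powr \<theta> + u)"
  proof (rule min_1_powr_le)
    \<comment> \<open>With the ratio \<open>c / s\<close> from \<open>cs\<close>, the base
      coefficient becomes \<open>1 / (6 * \<theta>)\<close> and the exponent
      \<open>2 * K * \<theta>\<close>.\<close>
    have r: "r = 1 / (6 * \<theta>) * (D + u)"
    proof -
      have "4 * K * c / (3 * s) = 4 * K / 3 * (c / s)" by simp
      also have "\<dots> = 1 / (6 * \<theta>)" unfolding cs using K \<theta> by (simp add: field_simps)
      finally show ?thesis by (simp add: r_def)
    qed
    show "0 \<le> r" unfolding r using D0 u0 \<theta> by simp
    have "1 / (6 * \<theta>) \<le> 1" using \<theta> by simp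
    then show "r \<le> D + u" unfolding r using D0 u0 by (intro mult_left_le_one_le) (use \<theta> in auto)
    have "s / (4 * c) = 1 / (4 * (c / s))" by simp
    also have "\<dots> = 2 * K * \<theta>" unfolding cs using K \<theta> by simp
    finally show "\<theta> \<le> s / (4 * c)" using K\<theta>2 \<theta> by linarith
  qed (use D0 u0 \<theta> in auto)
  finally have P: "P \<le> 2 * (exp_neg_div (\<delta>\<^sup>2 * \<alpha>\<^sup>2) (real n * T) + u + 2 powr \<theta> * (D powr \<theta> + u))"
    by simp
  have B: "M.prob {\<omega> \<in> space M. (\<Sum>k=1..n. Y k \<omega>) \<noteq> (\<Sum>k=1..n. U k \<omega>)} \<le> K * u"
    unfolding U_def u_def q_def c_def[symmetric]
    by (rule prob_sum_neq_truncated_sum_le[OF M Y n dom])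
  have "M.prob {\<omega> \<in> space M. \<bar>\<Sum>k=1..n. Y k \<omega>\<bar> \<ge> 3 * s}
    \<le> 2 * (P + M.prob {\<omega> \<in> space M. (\<Sum>k=1..n. Y k \<omega>) \<noteq> (\<Sum>k=1..n. U k \<omega>)})
      + (if \<bar>\<mu>\<bar> > s then 1 else 0)"
    unfolding P_def
  proof (rule M.prob_ge_le_median[OF _ _ med s])
    show "(\<lambda>\<omega>. \<Sum>k=1..n. Y k \<omega>) \<in> borel_measurable M"
      using Y by (rule borel_measurable_sum)
    show "(\<lambda>\<omega>. \<Sum>k=1..n. U k \<omega>) \<in> borel_measurable M"
    proof (rule borel_measurable_sum)
      fix k assume "k \<in> {1..n}"
      note [measurable] = Y[OF this]
      show "U k \<in> borel_measurable M" unfolding U_def by measurable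
    qed
  qed
  also have "\<dots> \<le> 2 * (2 * (exp_neg_div (\<delta>\<^sup>2 * \<alpha>\<^sup>2) (real n * T) + u + 2 powr \<theta> * (D powr \<theta> + u)) + K * u)
      + (if \<bar>\<mu>\<bar> > s then 1 else 0)"
    using P B by (intro add_mono mult_left_mono) auto
  also have "\<dots> = 4 * exp_neg_div (\<delta>\<^sup>2 * \<alpha>\<^sup>2) (real n * T) + (4 + 4 * 2 powr \<theta> + 2 * K) * u
      + 4 * 2 powr \<theta> * D powr \<theta> + (if \<bar>\<mu>\<bar> > s then 1 else 0)"
    by (simp add: algebra_simps)
  finally show ?thesis by (simp add: T_def c_def s_def u_def D_def mult.assoc)
qed

section \<open>Summing the tail bounds over the rows\<close>

theorem corollary2:
  fixes N :: "'a measure" and X :: "'a \<Rightarrow> real"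
    and M :: "'b measure" and Y :: "nat \<Rightarrow> nat \<Rightarrow> 'b \<Rightarrow> real"
    and K :: real and \<tau> a :: "nat \<Rightarrow> real"
  assumes "prob_space N" and "X \<in> borel_measurable N"
    and "prob_space M"
    and "\<And>n k. 1 \<le> k \<Longrightarrow> k \<le> n \<Longrightarrow> Y k n \<in> borel_measurable M"
    and "\<And>n. n \<ge> 1 \<Longrightarrow> prob_space.indep_vars M (\<lambda>_. borel) (\<lambda>k. Y k n) {1..n}"
    and "\<And>n. n \<ge> 1 \<Longrightarrow> weakly_mean_dominated K M n (\<lambda>k. Y k n) N X"
    and "\<And>n. n \<ge> 1 \<Longrightarrow> \<tau> n \<ge> 0"
    and "mono_on {1..} a" and "\<And>n. n \<ge> 1 \<Longrightarrow> a n > 0"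
    and medians: "\<exists>\<mu> :: nat \<Rightarrow> real.
          (\<forall>n\<ge>1. is_median M (row_sum Y n) (\<mu> n)) \<and>
          (\<forall>\<epsilon>>0. \<tau> summable_on {n. n \<ge> 1 \<and> \<bar>\<mu> n\<bar> > \<epsilon> * a n})"
    and regularity: "\<exists>(\<theta>::real) (C::real) (n0::nat). \<theta> \<ge> 1 \<and> C > 0 \<and> n0 \<ge> 2 \<and>
          (\<forall>n\<ge>n0.
             (\<lambda>k. real k powr \<theta> * \<tau> k / a k powr (3 * \<theta>)) summable_on {n..} \<and>
             a n powr (3 * \<theta>) / real n powr (\<theta> - 1) *
               (\<Sum>\<^sub>\<infinity>k\<in>{n..}. real k powr \<theta> * \<tau> k / a k powr (3 * \<theta>))
             \<le> C * (\<Sum>k=1..n-1. real k * \<tau> k)) \<and>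
          (\<theta> > 1 \<longrightarrow>
             liminf (\<lambda>n. INF k\<in>{n..}.
               ereal (a k ^ 3 / (real k * a n ^ 3) * (\<Sum>j=1..n-1. real j * \<tau> j))) > 0)"
    and tails: "\<And>\<epsilon>. \<epsilon> > 0 \<Longrightarrow>
          (\<lambda>n. real n * \<tau> n * \<P>(\<omega> in N. \<bar>X \<omega>\<bar> \<ge> \<epsilon> * a n)) summable_on {1..}"
    and exponentials: "\<And>\<epsilon>. \<epsilon> > 0 \<Longrightarrow>
          (\<lambda>n. \<tau> n * exp_neg_div (\<epsilon>\<^sup>2 * (a n)\<^sup>2)
                     (real n * truncated_second_moment N X (\<epsilon> * a n))) summable_on {1..}"
  shows "\<forall>\<epsilon>>0. (\<lambda>n. \<tau> n * \<P>(\<omega> in M. \<bar>row_sum Y n \<omega>\<bar> \<ge> \<epsilon> * a n)) summable_on {1..}"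
proof (intro allI impI)
  fix \<epsilon> :: real assume \<epsilon>: "\<epsilon> > 0"
  note N = assms(1) and X = assms(2) and M = assms(3) and indep = assms(5) and dom = assms(6)
    and \<tau> = assms(7) and mono = assms(8) and a = assms(9)
  interpret N: prob_space N by fact
  obtain \<mu> where \<mu>: "\<And>n. n \<ge> 1 \<Longrightarrow> is_median M (row_sum Y n) (\<mu> n)"
      "\<And>\<epsilon>. \<epsilon> > 0 \<Longrightarrow> \<tau> summable_on {n. n \<ge> 1 \<and> \<bar>\<mu> n\<bar> > \<epsilon> * a n}"
    using medians by blast
  obtain \<theta> C :: real and n0 :: nat where \<theta>: "\<theta> \<ge> 1" and C: "C > 0" and n0: "n0 \<ge> 2"
    and reg: "\<And>n. n \<ge> n0 \<Longrightarrow> (\<lambda>k. real k powr \<theta> * \<tau> k / a k powr (3 * \<theta>)) summable_on {n..} \<and>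
             a n powr (3 * \<theta>) / real n powr (\<theta> - 1) *
               (\<Sum>\<^sub>\<infinity>k\<in>{n..}. real k powr \<theta> * \<tau> k / a k powr (3 * \<theta>))
             \<le> C * (\<Sum>k=1..n-1. real k * \<tau> k)"
    and liminf: "\<theta> > 1 \<Longrightarrow> liminf (\<lambda>n. INF k\<in>{n..}.
               ereal (a k ^ 3 / (real k * a n ^ 3) * (\<Sum>j=1..n-1. real j * \<tau> j))) > 0"
    using regularity by blast
  \<comment> \<open>A positive limit inferior gives a positive constant below all the infima from
    some index on, hence a bound uniform in \<open>k\<close>.\<close>
  obtain b :: real and n1 :: nat where b: "\<theta> > 1 \<Longrightarrow> b > 0"
      "\<And>n k. \<theta> > 1 \<Longrightarrow> n \<ge> n1 \<Longrightarrow> k \<ge> n \<Longrightarrow>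
        b \<le> a k ^ 3 / (real k * a n ^ 3) * (\<Sum>j=1..n-1. real j * \<tau> j)"
  proof (cases "\<theta> > 1")
    case True
    obtain b where b: "0 < ereal b" "ereal b < liminf (\<lambda>n. INF k\<in>{n..}.
               ereal (a k ^ 3 / (real k * a n ^ 3) * (\<Sum>j=1..n-1. real j * \<tau> j)))"
      using ereal_dense2[OF liminf[OF True]] by blast
    from less_LiminfD[OF b(2)] obtain n1 where n1: "\<And>n. n \<ge> n1 \<Longrightarrow> ereal b < (INF k\<in>{n..}.
               ereal (a k ^ 3 / (real k * a n ^ 3) * (\<Sum>j=1..n-1. real j * \<tau> j)))"
      unfolding eventually_sequentially by blast
    have "b \<le> a k ^ 3 / (real k * a n ^ 3) * (\<Sum>j=1..n-1. real j * \<tau> j)"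
      if "n \<ge> n1" "k \<ge> n" for n k
    proof -
      have "(INF k\<in>{n..}. ereal (a k ^ 3 / (real k * a n ^ 3) * (\<Sum>j=1..n-1. real j * \<tau> j)))
          \<le> ereal (a k ^ 3 / (real k * a n ^ 3) * (\<Sum>j=1..n-1. real j * \<tau> j))"
        using that by (intro INF_lower) auto
      with n1[OF that(1)] have "ereal b < ereal (a k ^ 3 / (real k * a n ^ 3) * (\<Sum>j=1..n-1. real j * \<tau> j))"
        by (rule less_le_trans)
      then show ?thesis by simp
    qed
    then show ?thesis using that[of b n1] b(1) by simp
  next
    case False
    then show ?thesis using that by blast
  qed
  define m where "m = max n0 n1"
  have m: "m \<ge> n0" "m \<ge> n1" "m \<ge> 1" using n0 by (auto simp: m_def)
  have K: "K \<ge> 1"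
    using weakly_mean_dominated_const_ge_1[OF M N le_refl dom[OF le_refl]] .
  \<comment> \<open>The tail bound is stated at level \<open>3 * \<eta> * \<alpha>\<close>; the
    choice of \<delta> repeats the one made there.\<close>
  define \<eta> where "\<eta> = \<epsilon> / 3"
  define \<delta> where "\<delta> = \<eta> / (8 * K * \<theta>)"
  define Q where "Q n = \<P>(\<omega> in N. \<bar>X \<omega>\<bar> \<ge> \<delta> * a n)" for n
  \<comment> \<open>Dividing by \<open>\<delta> ^ 3\<close> makes the increments of \<open>H\<close>
    comparable with \<open>a (Suc n) ^ 3\<close> instead of
    \<open>(\<delta> * a (Suc n)) ^ 3\<close>, as the summation lemma requires.\<close>
  define H where "H n = (\<integral>\<omega>. \<bar>X \<omega>\<bar> ^ 3 * indicator {x. \<bar>x\<bar> < \<delta> * a n} (X \<omega>) \<partial>N) / \<delta> ^ 3" for n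
  define e where "e n = exp_neg_div (\<delta>\<^sup>2 * (a n)\<^sup>2) (real n * truncated_second_moment N X (\<delta> * a n))" for n
  have \<eta>: "\<eta> > 0" using \<epsilon> by (simp add: \<eta>_def)
  have \<delta>: "\<delta> > 0" using K \<theta> \<eta> by (simp add: \<delta>_def)
  have Q_sum: "(\<lambda>n. real n * \<tau> n * Q n) summable_on {1..}"
    unfolding Q_def by (rule tails[OF \<delta>])
  have e_sum: "(\<lambda>n. \<tau> n * e n) summable_on {1..}"
    unfolding e_def by (rule exponentials[OF \<delta>])
  \<comment> \<open>Summability over the set of exceptional indices is rewritten with an indicator,
    so that all four series run over the same index set.\<close>
  have \<mu>_sum: "(\<lambda>n. \<tau> n * (if \<bar>\<mu> n\<bar> > \<eta> * a n then 1 else 0)) summable_on {1..}"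
    using \<mu>(2)[OF \<eta>] by (rule summable_on_cong_neutral[THEN iffD1, rotated -1]) auto
  have D_sum: "(\<lambda>n. \<tau> n * (real n * H n / a n ^ 3) powr \<theta>) summable_on {1..}"
  proof (rule summable_truncated_moment_powr[OF \<theta> m(3) C \<tau> a _ _ _ _ _ Q_sum])
    fix n :: nat assume n: "n \<ge> 1"
    have "a n \<le> a (Suc n)" using mono n by (auto simp: mono_on_def)
    then have da: "0 \<le> \<delta> * a n" "\<delta> * a n \<le> \<delta> * a (Suc n)" using \<delta> a[OF n] by auto
    show "H n \<ge> 0" using \<delta> unfolding H_def by auto
    show "H n \<le> H (Suc n)"
      using truncated_moment_diff(1)[OF N X da, of 3] \<delta> by (simp add: H_def divide_right_mono)
    show "H (Suc n) - H n \<le> a (Suc n) ^ 3 * (Q n - Q (Suc n))"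
      using truncated_moment_diff(2)[OF N X da, of 3] \<delta>
      by (simp add: H_def Q_def diff_divide_distrib[symmetric] divide_le_eq power_mult_distrib mult_ac)
    show "Q n \<ge> 0" by (simp add: Q_def)
    have [measurable]: "X \<in> borel_measurable N" by (rule X)
    show "Q (Suc n) \<le> Q n"
      unfolding Q_def using da by (intro N.finite_measure_mono) auto
  next
    show "(\<lambda>k. real k powr \<theta> * \<tau> k / a k powr (3 * \<theta>)) summable_on {m..}"
      using reg m by blast
  next
    fix n assume "n \<ge> m"
    then show "a n powr (3 * \<theta>) / real n powr (\<theta> - 1) *
               (\<Sum>\<^sub>\<infinity>k\<in>{n..}. real k powr \<theta> * \<tau> k / a k powr (3 * \<theta>))
             \<le> C * (\<Sum>k=1..n-1. real k * \<tau> k)"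
      using reg m by auto
  qed (use b m in auto)
  show "(\<lambda>n. \<tau> n * \<P>(\<omega> in M. \<bar>row_sum Y n \<omega>\<bar> \<ge> \<epsilon> * a n)) summable_on {1..}"
  proof (rule summable_on_comparison_test)
    show "(\<lambda>n. 4 * (\<tau> n * e n) + (4 + 4 * 2 powr \<theta> + 2 * K) * (real n * \<tau> n * Q n)
        + 4 * 2 powr \<theta> * (\<tau> n * (real n * H n / a n ^ 3) powr \<theta>)
        + \<tau> n * (if \<bar>\<mu> n\<bar> > \<eta> * a n then 1 else 0)) summable_on {1..}"
      by (intro summable_on_add summable_on_cmult_right e_sum Q_sum D_sum \<mu>_sum)
  next
    fix n :: nat assume "n \<in> {1..}"
    then have n: "n \<ge> 1" by simp
    have "\<P>(\<omega> in M. \<bar>\<Sum>k=1..n. Y k n \<omega>\<bar> \<ge> 3 * \<eta> * a n)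
      \<le> 4 * e n + (4 + 4 * 2 powr \<theta> + 2 * K) * (real n * Q n)
        + 4 * 2 powr \<theta> * (real n * H n / a n ^ 3) powr \<theta>
        + (if \<bar>\<mu> n\<bar> > \<eta> * a n then 1 else 0)"
      unfolding e_def Q_def H_def \<delta>_def
      using \<mu>(1)[OF n] unfolding row_sum_def
      by (intro prob_sum_ge_le[OF M N X indep[OF n] n dom[OF n] _ a[OF n] \<eta> \<theta>])
    then have "\<tau> n * \<P>(\<omega> in M. \<bar>row_sum Y n \<omega>\<bar> \<ge> \<epsilon> * a n)
      \<le> \<tau> n * (4 * e n + (4 + 4 * 2 powr \<theta> + 2 * K) * (real n * Q n)
        + 4 * 2 powr \<theta> * (real n * H n / a n ^ 3) powr \<theta>
        + (if \<bar>\<mu> n\<bar> > \<eta> * a n then 1 else 0))"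
      using \<tau>[OF n] by (intro mult_left_mono) (auto simp: row_sum_def \<eta>_def)
    then show "\<tau> n * \<P>(\<omega> in M. \<bar>row_sum Y n \<omega>\<bar> \<ge> \<epsilon> * a n)
      \<le> 4 * (\<tau> n * e n) + (4 + 4 * 2 powr \<theta> + 2 * K) * (real n * \<tau> n * Q n)
        + 4 * 2 powr \<theta> * (\<tau> n * (real n * H n / a n ^ 3) powr \<theta>)
        + \<tau> n * (if \<bar>\<mu> n\<bar> > \<eta> * a n then 1 else 0)"
      by (simp add: algebra_simps)
  qed (use \<tau> in auto)
qed

end
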